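(* Let $\Omega_u,\Omega_d$ be complex $3\times3$ matrix-valued scalar fields, each of mass dimension one and the only family-carrying fields, transforming under $G_F=U(3)_Q\times U(3)_u\times U(3)_d$ by $\Omega_u\mapsto G_Q\Omega_uG_u^\dagger$, $\Omega_d\mapsto G_Q\Omega_dG_d^\dagger$. Put $X_f=\Omega_f\Omega_f^\dagger$ for $f=u,d$, and assume each $\Omega_f$ has three distinct nonzero singular values. Then: (1) Every renormalizable $G_F$-invariant term, i.e. every real $G_F$-invariant polynomial of total degree at most $4$ in the entries of $\Omega_u,\Omega_d$ and their complex conjugates, equals a function of the singular values of $\Omega_u$ and of $\Omega_d$ separately, plus $$V_{\rm orient}=\kappa_{ud}\operatorname{Tr}(X_uX_d)$$ for some $\kappa_{ud}\in\mathbb R$. (2) If $\kappa_{ud}\neq0$, then, with the singular values held fixed, every orientation that is stationary under relative left rotations $X_d\mapsto gX_dg^\dagger$, $g\in U(3)$, satisfies $[X_u,X_d]=0$; consequently $V_{\rm CKM}=U_u^\dagger U_d$ is a permutation matrix up to multiplication by diagonal unitary matrices. (3) If $\kappa_{ud}=0$, the potential is constant in the relative left orientation, so that orientation is a continuous flat direction. Hence such a potential has no isolated stationary relative orientation (modulo diagonal rephasings of $V_{\rm CKM}$) for which $V_{\rm CKM}$ is not a permutation matrix up to diagonal phases.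
   Context: Write the singular value decompositions $\Omega_f=U_fD_fW_f^\dagger$ with $U_f,W_f\in U(3)$ and $D_f$ positive diagonal, so $X_f=U_fD_f^2U_f^\dagger$. The relative left orientation is $V_{\rm CKM}=U_u^\dagger U_d$, defined up to left and right multiplication by diagonal unitary matrices. "Renormalizable" means polynomial of degree at most four in the dimension-one fields and their conjugates. *)

theory Defs
  imports "HOL-Analysis.Analysis" "HOL-Library.Poly_Mapping"
begin

type_synonym cmat3 = "complex^3^3"

definition hconj :: "cmat3 \<Rightarrow> cmat3" where
  "hconj A = (\<chi> i j. cnj (A $ j $ i))"

definition unitary :: "cmat3 \<Rightarrow> bool" where
  "unitary U \<longleftrightarrow> U ** hconj U = mat 1 \<and> hconj U ** U = mat 1"

definition diagonal_unitary :: "cmat3 \<Rightarrow> bool" where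
  "diagonal_unitary P \<longleftrightarrow> unitary P \<and> (\<forall>i j. i \<noteq> j \<longrightarrow> P $ i $ j = 0)"

definition positive_diagonal :: "cmat3 \<Rightarrow> bool" where
  "positive_diagonal D \<longleftrightarrow>
     (\<forall>i. D $ i $ i \<in> \<real> \<and> 0 < Re (D $ i $ i)) \<and> (\<forall>i j. i \<noteq> j \<longrightarrow> D $ i $ j = 0)"

definition permutation_matrix :: "cmat3 \<Rightarrow> bool" where
  "permutation_matrix P \<longleftrightarrow> (\<exists>\<pi> :: 3 \<Rightarrow> 3. bij \<pi> \<and> P = (\<chi> i j. if i = \<pi> j then 1 else 0))"


subsection \<open>Singular values\<close>

text \<open>The singular values are recorded as a set, without multiplicities. On matrices with three
  distinct singular values, the only ones used below, this loses nothing.\<close>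

definition singular_values :: "cmat3 \<Rightarrow> real set" where
  "singular_values A =
     {s. 0 \<le> s \<and> (\<exists>v. v \<noteq> 0 \<and> (hconj A ** A) *v v = complex_of_real (s\<^sup>2) *s v)}"

definition three_distinct_nonzero_sv :: "cmat3 \<Rightarrow> bool" where
  "three_distinct_nonzero_sv A \<longleftrightarrow> card (singular_values A) = 3 \<and> 0 \<notin> singular_values A"

definition is_svd :: "cmat3 \<Rightarrow> cmat3 \<Rightarrow> cmat3 \<Rightarrow> cmat3 \<Rightarrow> bool" where
  "is_svd A U D W \<longleftrightarrow>
     unitary U \<and> unitary W \<and> positive_diagonal D \<and> A = U ** D ** hconj W"

definition gram :: "cmat3 \<Rightarrow> cmat3" where
  "gram A = A ** hconj A"


subsection \<open>Renormalizable invariant potentials\<close>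

text \<open>A polynomial in the 18 complex entries of the two fields and their 18 conjugates is a finitely
  supported map from monomials (exponent vectors) to complex coefficients. Coefficients are
  complex; reality is a condition on the values of the polynomial.\<close>

datatype sector = Up | Down

datatype field_var = Entry sector 3 3 | Conj_Entry sector 3 3

type_synonym field_poly = "(field_var \<Rightarrow>\<^sub>0 nat) \<Rightarrow>\<^sub>0 complex"

fun field_of :: "cmat3 \<Rightarrow> cmat3 \<Rightarrow> sector \<Rightarrow> cmat3" where
  "field_of \<Omega>u \<Omega>d Up = \<Omega>u"
| "field_of \<Omega>u \<Omega>d Down = \<Omega>d"

fun var_value :: "cmat3 \<Rightarrow> cmat3 \<Rightarrow> field_var \<Rightarrow> complex" where
  "var_value \<Omega>u \<Omega>d (Entry f i j) = field_of \<Omega>u \<Omega>d f $ i $ j"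
| "var_value \<Omega>u \<Omega>d (Conj_Entry f i j) = cnj (field_of \<Omega>u \<Omega>d f $ i $ j)"

definition poly_value :: "field_poly \<Rightarrow> cmat3 \<Rightarrow> cmat3 \<Rightarrow> complex" where
  "poly_value p \<Omega>u \<Omega>d =
     (\<Sum>m\<in>Poly_Mapping.keys p. Poly_Mapping.lookup p m *
        (\<Prod>x\<in>Poly_Mapping.keys m. var_value \<Omega>u \<Omega>d x ^ Poly_Mapping.lookup m x))"

definition total_degree_le :: "nat \<Rightarrow> field_poly \<Rightarrow> bool" where
  "total_degree_le n p \<longleftrightarrow>
     (\<forall>m\<in>Poly_Mapping.keys p. (\<Sum>x\<in>Poly_Mapping.keys m. Poly_Mapping.lookup m x) \<le> n)"

definition renormalizable :: "(cmat3 \<Rightarrow> cmat3 \<Rightarrow> real) \<Rightarrow> bool" where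
  "renormalizable V \<longleftrightarrow>
     (\<exists>p. total_degree_le 4 p \<and>
        (\<forall>\<Omega>u \<Omega>d. poly_value p \<Omega>u \<Omega>d = complex_of_real (V \<Omega>u \<Omega>d)))"

definition flavour_invariant :: "(cmat3 \<Rightarrow> cmat3 \<Rightarrow> real) \<Rightarrow> bool" where
  "flavour_invariant V \<longleftrightarrow>
     (\<forall>GQ Gu Gd \<Omega>u \<Omega>d. unitary GQ \<and> unitary Gu \<and> unitary Gd \<longrightarrow>
        V (GQ ** \<Omega>u ** hconj Gu) (GQ ** \<Omega>d ** hconj Gd) = V \<Omega>u \<Omega>d)"


subsection \<open>Relative left orientation\<close>

definition ckm :: "cmat3 \<Rightarrow> cmat3 \<Rightarrow> cmat3" where
  "ckm Uu Ud = hconj Uu ** Ud"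

definition rephasing_equiv :: "cmat3 \<Rightarrow> cmat3 \<Rightarrow> bool" where
  "rephasing_equiv V V' \<longleftrightarrow>
     (\<exists>P Q. diagonal_unitary P \<and> diagonal_unitary Q \<and> V' = P ** V ** Q)"

definition permutation_up_to_phases :: "cmat3 \<Rightarrow> bool" where
  "permutation_up_to_phases V \<longleftrightarrow> (\<exists>P. permutation_matrix P \<and> rephasing_equiv P V)"

text \<open>A relative left rotation \<open>g\<close> replaces \<open>\<Omega>d\<close> by \<open>g ** \<Omega>d\<close>. It sends \<open>gram \<Omega>d\<close> to
  \<open>g ** gram \<Omega>d ** hconj g\<close>, keeps all singular values, and replaces \<open>Ud\<close> by \<open>g ** Ud\<close> in a
  singular value decomposition of \<open>\<Omega>d\<close>. Stationarity is the vanishing of the derivative along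
  every curve in \<open>U(3)\<close> through the identity that is differentiable there.\<close>

definition stationary_orientation ::
  "(cmat3 \<Rightarrow> cmat3 \<Rightarrow> real) \<Rightarrow> cmat3 \<Rightarrow> cmat3 \<Rightarrow> bool" where
  "stationary_orientation V \<Omega>u \<Omega>d \<longleftrightarrow>
     (\<forall>\<gamma> :: real \<Rightarrow> cmat3. (\<forall>t. unitary (\<gamma> t)) \<and> \<gamma> 0 = mat 1 \<and> \<gamma> differentiable (at 0) \<longrightarrow>
        ((\<lambda>t. V \<Omega>u (\<gamma> t ** \<Omega>d)) has_real_derivative 0) (at 0))"

text \<open>A stationary orientation is isolated if its class modulo rephasing is an isolated point of
  the set of stationary classes. A neighbourhood of a class is the saturation of a neighbourhood of
  a representative, so a ball around the representative \<open>ckm Uu Ud\<close> suffices.\<close>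

definition isolated_stationary_orientation ::
  "(cmat3 \<Rightarrow> cmat3 \<Rightarrow> real) \<Rightarrow> cmat3 \<Rightarrow> cmat3 \<Rightarrow> cmat3 \<Rightarrow> cmat3 \<Rightarrow> bool" where
  "isolated_stationary_orientation V \<Omega>u \<Omega>d Uu Ud \<longleftrightarrow>
     stationary_orientation V \<Omega>u \<Omega>d \<and>
     (\<exists>\<epsilon>>0. \<forall>g. unitary g \<and> stationary_orientation V \<Omega>u (g ** \<Omega>d) \<and>
        dist (ckm Uu (g ** Ud)) (ckm Uu Ud) < \<epsilon> \<longrightarrow>
        rephasing_equiv (ckm Uu Ud) (ckm Uu (g ** Ud)))"

text \<open>A continuous flat direction is a path of relative rotations along which the potential is
  constant while the orientation, modulo rephasing, really moves.\<close>

definition continuous_flat_direction ::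
  "(cmat3 \<Rightarrow> cmat3 \<Rightarrow> real) \<Rightarrow> cmat3 \<Rightarrow> cmat3 \<Rightarrow> cmat3 \<Rightarrow> cmat3 \<Rightarrow> bool" where
  "continuous_flat_direction V \<Omega>u \<Omega>d Uu Ud \<longleftrightarrow>
     (\<exists>\<gamma>. path \<gamma> \<and> pathstart \<gamma> = mat 1 \<and>
        (\<forall>t\<in>{0..1}. unitary (\<gamma> t) \<and> V \<Omega>u (\<gamma> t ** \<Omega>d) = V \<Omega>u \<Omega>d) \<and>
        (\<forall>t\<in>{0<..1}. \<not> rephasing_equiv (ckm Uu Ud) (ckm Uu (\<gamma> t ** Ud))))"

end

theory Submission
  imports Defs
begin

text \<open>
  Averaging an invariant quartic over the signs of both fields splits it into a part depending on
  \<open>\<Omega>u\<close> alone, a part depending on \<open>\<Omega>d\<close> alone and a form that is quadratic in each field. A quadratic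
  form invariant under a sign flip of some coordinates has no cross terms between these and the
  others; so, with \<open>\<Omega>u\<close> brought to diagonal form by its singular value decomposition, flips of rows
  and columns reduce the mixed form to the squared moduli of entries, and permutation matrices
  leave two free coefficients: those of \<open>Tr Xu Tr Xd\<close> and of \<open>Tr (Xu Xd)\<close>.

  For an orthogonal projector \<open>P\<close>, differentiating along \<open>exp (\<i> t P)\<close> gives \<open>Tr (P [Xd, Xu]) = 0\<close> at
  a stationary orientation; as projectors span all matrices, \<open>Xu\<close> and \<open>Xd\<close> commute, and simplicity
  of their spectra makes the CKM matrix monomial. If \<open>\<kappa> = 0\<close>, a curve \<open>exp (\<i> t P)\<close> for which the
  largest entry of a column of the CKM matrix shrinks is a flat direction, because moduli of entries
  are invariant under rephasing.
\<close>

subsection \<open>Matrices\<close>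

lemma hconj_nth [simp]: "hconj A $ i $ j = cnj (A $ j $ i)"
  by (simp add: hconj_def)

lemma matrix_mult_nth: "(A ** B) $ i $ j = (\<Sum>k\<in>UNIV. A $ i $ k * B $ k $ j)"
  by (simp add: matrix_matrix_mult_def)

lemma hconj_mult: "hconj (A ** B) = hconj B ** hconj A"
  by (simp add: vec_eq_iff matrix_mult_nth mult.commute)

lemma hconj_hconj [simp]: "hconj (hconj A) = A"
  by (simp add: vec_eq_iff)

lemma hconj_mat_1 [simp]: "hconj (mat 1) = mat 1"
  by (simp add: vec_eq_iff mat_def)

lemma unitaryI: "hconj U ** U = mat 1 \<Longrightarrow> unitary U"
  by (simp add: unitary_def matrix_left_right_inverse)

lemma unitary_mat_1 [simp]: "unitary (mat 1)"
  by (simp add: unitary_def)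

lemma unitary_hconj [simp]: "unitary (hconj U) \<longleftrightarrow> unitary U"
  by (auto simp: unitary_def)

text \<open>All bracketings are listed because the cancelling pair may sit at either end of a
  product or next to a further factor.\<close>

lemma unitary_cancel:
  assumes "unitary U"
  shows "hconj U ** U = mat 1" "U ** hconj U = mat 1"
    "X ** hconj U ** U = X" "X ** U ** hconj U = X"
    "hconj U ** (U ** X) = X" "U ** (hconj U ** X) = X"
  using assms by (simp_all add: unitary_def flip: matrix_mul_assoc)
    (simp_all add: matrix_mul_assoc)

lemma unitary_mult:
  assumes "unitary A" "unitary B"
  shows "unitary (A ** B)"
proof (rule unitaryI)
  have "hconj (A ** B) ** (A ** B) = hconj B ** (hconj A ** (A ** B))"
    by (simp add: hconj_mult matrix_mul_assoc)
  then show "hconj (A ** B) ** (A ** B) = mat 1"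
    by (simp only: unitary_cancel[OF assms(1)] unitary_cancel[OF assms(2)])
qed

lemma trace_cyclic: "trace (A ** B ** C) = trace (C ** A ** (B :: cmat3))"
  by (metis matrix_mul_assoc trace_mul_sym)

lemma trace_gram: "trace (gram A) = (\<Sum>i\<in>UNIV. \<Sum>j\<in>UNIV. complex_of_real ((norm (A $ i $ j))\<^sup>2))"
  by (simp add: trace_def gram_def matrix_mult_nth complex_norm_square del: of_real_power)

section \<open>Diagonal matrices and diagonal unitaries\<close>

definition diag :: "(3 \<Rightarrow> complex) \<Rightarrow> cmat3" where
  "diag f = (\<chi> i j. if i = j then f i else 0)"

lemma diag_nth: "diag f $ i $ j = (if i = j then f i else 0)"
  by (simp add: diag_def)

lemma diag_mult_nth [simp]: "(diag f ** A) $ i $ j = f i * A $ i $ j"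
  by (simp add: matrix_mult_nth diag_nth if_distrib[where f="\<lambda>x. x * _"] cong: if_cong)

lemma mult_diag_nth [simp]: "(A ** diag f) $ i $ j = A $ i $ j * f j"
  by (simp add: matrix_mult_nth diag_nth if_distrib[where f="\<lambda>x. _ * x"] cong: if_cong)

lemma hconj_diag [simp]: "hconj (diag f) = diag (\<lambda>i. cnj (f i))"
  by (simp add: vec_eq_iff diag_nth)

lemma diag_mult_diag [simp]: "diag f ** diag g = diag (\<lambda>i. f i * g i)"
  by (simp add: vec_eq_iff diag_nth)

lemma diag_1: "diag (\<lambda>i. 1) = mat 1"
  by (simp add: vec_eq_iff diag_nth mat_def)

lemma diagonal_unitary_diag:
  assumes "\<And>i. norm (f i) = 1"
  shows "diagonal_unitary (diag f)"
proof -
  have "cnj (f i) * f i = 1" for i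
    using complex_norm_square[of "f i"] assms[of i] by (simp add: mult.commute)
  then show ?thesis
    by (simp add: diagonal_unitary_def diag_nth unitaryI diag_1)
qed

lemma diagonal_unitaryE:
  assumes "diagonal_unitary P"
  obtains f where "P = diag f" "\<And>i. norm (f i) = 1"
proof
  show P: "P = diag (\<lambda>i. P $ i $ i)"
    using assms by (auto simp: diagonal_unitary_def vec_eq_iff diag_nth)
  show "norm (P $ i $ i) = 1" for i
  proof -
    have "(P ** hconj P) $ i $ i = 1"
      using assms by (simp add: diagonal_unitary_def unitary_def mat_def)
    moreover have "(P ** hconj P) $ i $ i = P $ i $ i * cnj (P $ i $ i)"
      by (subst P, subst P) (simp add: diag_nth)
    ultimately have "complex_of_real ((norm (P $ i $ i))\<^sup>2) = 1"
      by (metis complex_norm_square)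
    then show ?thesis
      by (metis norm_ge_zero of_real_eq_1_iff power2_eq_iff_nonneg one_power2 zero_le_one)
  qed
qed

lemma unitary_row:
  assumes "unitary V"
  shows "(\<Sum>j\<in>UNIV. V $ i $ j * cnj (V $ k $ j)) = (if i = k then 1 else 0)"
proof -
  have "(V ** hconj V) $ i $ k = mat 1 $ i $ k"
    using assms by (simp add: unitary_def)
  then show ?thesis
    by (simp add: matrix_mult_nth mat_def)
qed

subsection \<open>Singular values\<close>

lemma singular_values_unitary:
  assumes "unitary g"
  shows "singular_values (g ** A) = singular_values A"
proof -
  have "hconj (g ** A) ** (g ** A) = hconj A ** (hconj g ** (g ** A))"
    by (simp add: hconj_mult matrix_mul_assoc)
  also have "\<dots> = hconj A ** A"
    by (simp only: unitary_cancel[OF assms])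
  finally show ?thesis
    by (simp add: singular_values_def)
qed

lemma three_distinct_unitary:
  "unitary g \<Longrightarrow> three_distinct_nonzero_sv (g ** A) \<longleftrightarrow> three_distinct_nonzero_sv A"
  by (simp add: three_distinct_nonzero_sv_def singular_values_unitary)

text \<open>Eigenvectors of \<open>hconj A ** A\<close> for distinct eigenvalues are orthogonal, so
  after normalisation they are the columns of \<open>W\<close>; dividing the columns of
  \<open>A ** W\<close> by the singular values gives \<open>U\<close>. The enumeration
  \<open>s\<close> prescribes the order on the diagonal, so that all matrices with the same singular
  values share one diagonal factor.\<close>

lemma exists_svd:
  assumes "three_distinct_nonzero_sv A" "bij_betw s UNIV (singular_values A)"
  shows "\<exists>U W. unitary U \<and> unitary W \<and> A = U ** diag (\<lambda>i. complex_of_real (s i)) ** hconj W"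
proof -
  let ?G = "hconj A ** A"
  let ?c = "complex_of_real"
  have mem: "s i \<in> singular_values A" for i
    using assms(2) by (auto simp: bij_betw_def)
  have s0: "s i > 0" for i
    using mem[of i] assms(1) by (force simp: singular_values_def three_distinct_nonzero_sv_def)
  have sinj: "s i = s j \<longleftrightarrow> i = j" for i j
    using assms(2) by (auto simp: bij_betw_def inj_def)
  have "\<exists>v. v \<noteq> 0 \<and> ?G *v v = ?c ((s i)\<^sup>2) *s v" for i
    using mem[of i] by (auto simp: singular_values_def)
  then obtain v where v: "\<And>i. v i \<noteq> 0" "\<And>i. ?G *v v i = ?c ((s i)\<^sup>2) *s v i"
    by metis
  \<comment> \<open>The Hermitian inner product, conjugate linear in its first argument.\<close>
  define ip where "ip = (\<lambda>(x::complex^3) y. \<Sum>k\<in>UNIV. cnj (x $ k) * y $ k)"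
  have ip_pos: "ip (v i) (v i) = ?c ((norm (v i))\<^sup>2)" for i
    by (simp add: ip_def norm_vec_def L2_set_def sum_nonneg complex_norm_square mult.commute
        del: of_real_power)
  have herm: "ip x (?G *v y) = ip (?G *v x) y" for x y
  proof -
    have G: "cnj (?G $ k $ l) = ?G $ l $ k" for k l
      by (simp add: matrix_mult_nth mult.commute)
    have "ip x (?G *v y) = (\<Sum>k\<in>UNIV. \<Sum>l\<in>UNIV. cnj (x $ k) * (?G $ k $ l * y $ l))"
      by (simp add: ip_def matrix_vector_mult_def sum_distrib_left)
    also have "\<dots> = (\<Sum>l\<in>UNIV. \<Sum>k\<in>UNIV. cnj (x $ k) * (?G $ k $ l * y $ l))"
      by (rule sum.swap)
    also have "\<dots> = (\<Sum>l\<in>UNIV. \<Sum>k\<in>UNIV. cnj (?G $ l $ k * x $ k) * y $ l)"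
      by (simp only: complex_cnj_mult G mult_ac)
    also have "\<dots> = ip (?G *v x) y"
      by (simp add: ip_def matrix_vector_mult_def sum_distrib_right)
    finally show ?thesis .
  qed
  have orth: "ip (v i) (v j) = 0" if "i \<noteq> j" for i j
  proof -
    have "?c ((s j)\<^sup>2) * ip (v i) (v j) = ?c ((s i)\<^sup>2) * ip (v i) (v j)"
      using herm[of "v i" "v j"] by (simp add: v ip_def sum_distrib_left mult_ac)
    moreover have "(s i)\<^sup>2 \<noteq> (s j)\<^sup>2"
      using s0[of i] s0[of j] sinj that by (metis power2_eq_imp_eq less_imp_le)
    ultimately show ?thesis
      by (metis mult_cancel_right of_real_eq_iff)
  qed
  define W :: cmat3 where "W = (\<chi> k i. v i $ k / ?c (norm (v i)))"
  have "(hconj W ** W) $ i $ j = ip (v i) (v j) / (?c (norm (v i)) * ?c (norm (v j)))" for i j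
    by (simp add: W_def matrix_mult_nth ip_def sum_divide_distrib)
  then have "(hconj W ** W) $ i $ j = mat 1 $ i $ j" for i j
    using v(1) by (cases "i = j") (simp_all add: orth ip_pos mat_def power2_eq_square)
  then have uW: "unitary W"
    by (simp add: unitaryI vec_eq_iff)
  have GW: "?G ** W = W ** diag (\<lambda>i. ?c ((s i)\<^sup>2))"
  proof -
    have "(\<Sum>l\<in>UNIV. ?G $ k $ l * v i $ l) = ?c ((s i)\<^sup>2) * v i $ k" for i k
      using v(2)[of i] by (simp add: vec_eq_iff matrix_vector_mult_def)
    then have "(\<Sum>l\<in>UNIV. ?G $ k $ l * (v i $ l / z)) = (v i $ k / z) * ?c ((s i)\<^sup>2)" for i k z
      by (simp flip: sum_divide_distrib)
    then show ?thesis
      unfolding vec_eq_iff mult_diag_nth matrix_mult_nth[of "hconj A ** A" W] by (simp add: W_def)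
  qed
  \<comment> \<open>\<open>S\<close> inverts the diagonal factor; this uses that no singular value
    is zero.\<close>
  define S where "S = diag (\<lambda>i. ?c (1 / s i))"
  define U where "U = A ** W ** S"
  have "hconj U ** U = S ** (hconj W ** (?G ** W)) ** S"
    by (simp add: U_def hconj_mult matrix_mul_assoc) (simp add: S_def)
  also have "\<dots> = mat 1"
    unfolding GW unitary_cancel[OF uW]
    using s0 by (simp add: S_def power2_eq_square less_imp_neq[THEN not_sym] flip: diag_1)
  finally have "unitary U"
    by (rule unitaryI)
  moreover have "U ** diag (\<lambda>i. ?c (s i)) ** hconj W = A ** W ** (S ** diag (\<lambda>i. ?c (s i))) ** hconj W"
    by (simp add: U_def matrix_mul_assoc)
  then have "A = U ** diag (\<lambda>i. ?c (s i)) ** hconj W"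
    using s0 by (simp add: S_def less_imp_neq[THEN not_sym] diag_1 unitary_cancel[OF uW])
  ultimately show ?thesis
    using uW by blast
qed

lemma gram_svd:
  assumes "unitary W" "X = U ** diag (\<lambda>i. complex_of_real (d i)) ** hconj W"
  shows "gram X = U ** diag (\<lambda>i. complex_of_real ((d i)\<^sup>2)) ** hconj U"
proof -
  let ?D = "diag (\<lambda>i. complex_of_real (d i))"
  have "gram X = U ** (?D ** (hconj W ** (W ** ?D))) ** hconj U"
    by (simp add: gram_def assms(2) hconj_mult matrix_mul_assoc)
  then show ?thesis
    by (simp add: unitary_cancel[OF assms(1)] power2_eq_square)
qed

lemma trace_gram_svd:
  assumes "unitary U" "unitary W" "X = U ** diag (\<lambda>i. complex_of_real (d i)) ** hconj W"
  shows "trace (gram X) = complex_of_real (\<Sum>i\<in>UNIV. (d i)\<^sup>2)"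
  unfolding gram_svd[OF assms(2,3)] trace_cyclic[of U] unitary_cancel[OF assms(1)]
  by (simp add: trace_def diag_nth unitary_cancel[OF assms(1)])

text \<open>The converse direction, for an arbitrary given decomposition: each singular value occurs
  on the diagonal of \<open>D\<close>, and three values among three entries leave no room for a
  repetition.\<close>

lemma svd_diag_inj:
  assumes "three_distinct_nonzero_sv A" "is_svd A U D W"
  obtains d where "D = diag (\<lambda>i. complex_of_real (d i))" "inj d" "\<And>i. d i > 0"
proof -
  define d where "d i = Re (D $ i $ i)" for i
  have D: "D = diag (\<lambda>i. complex_of_real (d i))" and pos: "d i > 0" for i
    using assms(2)
    by (auto simp: is_svd_def positive_diagonal_def vec_eq_iff diag_nth d_def complex_is_Real_iff complex_eq_iff)
  have un: "unitary U" "unitary W" and A: "A = U ** D ** hconj W"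
    using assms(2) by (auto simp: is_svd_def)
  have "hconj A ** A = W ** hconj D ** (hconj U ** (U ** (D ** hconj W)))"
    by (simp add: A hconj_mult matrix_mul_assoc)
  also have "\<dots> = W ** (diag (\<lambda>i. complex_of_real ((d i)\<^sup>2)) ** hconj W)"
    unfolding unitary_cancel[OF un(1)]
    by (simp add: D power2_eq_square matrix_mul_assoc) (simp flip: matrix_mul_assoc)
  finally have G: "hconj W ** (hconj A ** A) = diag (\<lambda>i. complex_of_real ((d i)\<^sup>2)) ** hconj W"
    by (simp only: unitary_cancel[OF un(2)])
  have "singular_values A \<subseteq> range d"
  proof
    fix s assume "s \<in> singular_values A"
    then obtain v where s: "0 \<le> s" and v: "v \<noteq> 0" "(hconj A ** A) *v v = complex_of_real (s\<^sup>2) *s v"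
      by (auto simp: singular_values_def)
    \<comment> \<open>Coordinates with respect to the columns of \<open>W\<close>, in which
      \<open>hconj A ** A\<close> becomes diagonal.\<close>
    define w where "w = hconj W *v v"
    have "diag (\<lambda>i. complex_of_real ((d i)\<^sup>2)) *v w = hconj W *v ((hconj A ** A) *v v)"
      by (simp add: w_def matrix_vector_mul_assoc G)
    also have "\<dots> = complex_of_real (s\<^sup>2) *s w"
      by (simp add: v w_def vector_scalar_commute)
    finally have eq: "(diag (\<lambda>i. complex_of_real ((d i)\<^sup>2)) *v w) $ i = (complex_of_real (s\<^sup>2) *s w) $ i" for i
      by simp
    have "W *v w = v"
      by (simp add: w_def matrix_vector_mul_assoc unitary_cancel[OF un(2)])
    then have "w \<noteq> 0"
      using v(1) by auto
    then obtain i where i: "w $ i \<noteq> 0"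
      by (auto simp: vec_eq_iff)
    have "complex_of_real ((d i)\<^sup>2) * w $ i = complex_of_real (s\<^sup>2) * w $ i"
      using eq[of i]
      by (simp add: matrix_vector_mult_def diag_nth if_distrib[where f="\<lambda>x. x * _"] cong: if_cong)
    then have "(d i)\<^sup>2 = s\<^sup>2"
      using i by (metis mult_cancel_right of_real_eq_iff)
    then have "d i = s"
      using s pos[of i] by (simp add: power2_eq_iff_nonneg)
    then show "s \<in> range d" by blast
  qed
  then have "card (range d) \<ge> 3"
    using assms(1) card_mono[of "range d" "singular_values A"]
    by (simp add: three_distinct_nonzero_sv_def)
  then have "inj d"
    using card_image_le[of UNIV d] by (intro eq_card_imp_inj_on) simp_all
  with D pos that show ?thesis by blast
qed

subsection \<open>The mixed part of an invariant quartic\<close>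

fun sector_of :: "field_var \<Rightarrow> sector" where
  "sector_of (Entry f i j) = f"
| "sector_of (Conj_Entry f i j) = f"

fun entry_value :: "cmat3 \<Rightarrow> field_var \<Rightarrow> complex" where
  "entry_value Z (Entry f i j) = Z $ i $ j"
| "entry_value Z (Conj_Entry f i j) = cnj (Z $ i $ j)"

text \<open>A list of variables stands for a monomial in one field: the degree is the length, and a
  monomial of degree two is visibly a product of two real linear functionals.\<close>

definition word_value :: "cmat3 \<Rightarrow> field_var list \<Rightarrow> complex" where
  "word_value Z xs = prod_list (map (entry_value Z) xs)"

text \<open>Each variable is repeated as often as its exponent says. The list is chosen before the
  valuation \<open>v\<close>, so one word serves all field values.\<close>

lemma prod_power_as_list:
  assumes "finite K"
  shows "\<exists>xs. length xs = (\<Sum>x\<in>K. e x) \<and>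
    (\<forall>v :: 'a \<Rightarrow> 'b::comm_monoid_mult. (\<Prod>x\<in>K. v x ^ e x) = prod_list (map v xs))"
  using assms
proof (induction K)
  case empty
  show ?case by (intro exI[of _ "[]"]) simp
next
  case (insert x K)
  then obtain xs where "length xs = (\<Sum>x\<in>K. e x)"
    "\<forall>v :: 'a \<Rightarrow> 'b. (\<Prod>x\<in>K. v x ^ e x) = prod_list (map v xs)"
    by blast
  with insert show ?case
    by (intro exI[of _ "replicate (e x) x @ xs"]) (simp add: prod_list_replicate)
qed

lemma renormalizable_words:
  assumes "renormalizable V"
  shows "\<exists>(I :: (field_var \<Rightarrow>\<^sub>0 nat) set) us ds c. finite I \<and>
    (\<forall>m\<in>I. length (us m) + length (ds m) \<le> 4) \<and>
    (\<forall>X Y. complex_of_real (V X Y) = (\<Sum>m\<in>I. c m * word_value X (us m) * word_value Y (ds m)))"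
proof -
  obtain p where p: "total_degree_le 4 p" "\<And>X Y. poly_value p X Y = complex_of_real (V X Y)"
    using assms by (auto simp: renormalizable_def)
  let ?I = "Poly_Mapping.keys p"
  let ?K = "\<lambda>m f. {x \<in> Poly_Mapping.keys m. sector_of x = f}"
  have "\<exists>xs. length xs = (\<Sum>x\<in>?K m f. Poly_Mapping.lookup m x) \<and>
    (\<forall>v :: _ \<Rightarrow> complex. (\<Prod>x\<in>?K m f. v x ^ Poly_Mapping.lookup m x) = prod_list (map v xs))" for m f
    by (rule prod_power_as_list) simp
  then obtain w where w: "\<And>m f. length (w m f) = (\<Sum>x\<in>?K m f. Poly_Mapping.lookup m x)"
    "\<And>m f (v :: _ \<Rightarrow> complex). (\<Prod>x\<in>?K m f. v x ^ Poly_Mapping.lookup m x) = prod_list (map v (w m f))"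
    by metis
  have keys: "Poly_Mapping.keys m = ?K m Up \<union> ?K m Down" for m
    using sector.exhaust by blast
  have disj: "?K m Up \<inter> ?K m Down = {}" for m
    by auto
  have val: "var_value X Y x = entry_value (field_of X Y (sector_of x)) x" for X Y x
    by (cases x) auto
  show ?thesis
  proof (intro exI conjI ballI allI)
    fix m assume "m \<in> ?I"
    then have "(\<Sum>x\<in>Poly_Mapping.keys m. Poly_Mapping.lookup m x) \<le> 4"
      using p(1) by (auto simp: total_degree_le_def)
    then show "length (w m Up) + length (w m Down) \<le> 4"
      by (subst (asm) keys) (simp add: w sum.union_disjoint[OF _ _ disj])
  next
    fix X Y
    have "(\<Prod>x\<in>Poly_Mapping.keys m. var_value X Y x ^ Poly_Mapping.lookup m x) =
        word_value X (w m Up) * word_value Y (w m Down)" for m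
    proof -
      have "(\<Prod>x\<in>Poly_Mapping.keys m. var_value X Y x ^ Poly_Mapping.lookup m x) =
          (\<Prod>x\<in>?K m Up. var_value X Y x ^ Poly_Mapping.lookup m x) *
          (\<Prod>x\<in>?K m Down. var_value X Y x ^ Poly_Mapping.lookup m x)"
        by (subst keys) (simp add: prod.union_disjoint[OF _ _ disj])
      also have "\<dots> = (\<Prod>x\<in>?K m Up. entry_value X x ^ Poly_Mapping.lookup m x) *
          (\<Prod>x\<in>?K m Down. entry_value Y x ^ Poly_Mapping.lookup m x)"
        by (intro arg_cong2[of _ _ _ _ "(*)"] prod.cong) (auto simp: val)
      finally show ?thesis
        by (simp add: w word_value_def)
    qed
    then show "complex_of_real (V X Y) = (\<Sum>m\<in>?I. Poly_Mapping.lookup p m * word_value X (w m Up) * word_value Y (w m Down))"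
      by (simp add: p(2)[symmetric] poly_value_def mult.assoc)
  qed simp
qed

lemma entry_value_add: "entry_value (X + Y) x = entry_value X x + entry_value Y x"
  by (cases x) auto

lemma entry_value_scaleR: "entry_value (r *\<^sub>R X) x = of_real r * entry_value X x"
  by (cases x) (auto simp: scaleR_conv_of_real[of _ "_ :: complex"])

lemma entry_value_uminus: "entry_value (- X) x = - entry_value X x"
  by (cases x) auto

lemma entry_value_diff: "entry_value (X - Y) x = entry_value X x - entry_value Y x"
  by (cases x) auto

lemma entry_value_0: "entry_value 0 x = 0"
  by (cases x) auto

lemma word_value_uminus: "word_value (- X) xs = (-1) ^ length xs * word_value X xs"
  by (induction xs) (auto simp: word_value_def entry_value_uminus)

lemma word_value_0: "word_value 0 xs = (if xs = [] then 1 else 0)"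
  by (cases xs) (auto simp: word_value_def entry_value_0)

lemma word_value_length_2:
  assumes "length xs = 2"
  shows "\<exists>a b. \<forall>Z. word_value Z xs = entry_value Z a * entry_value Z b"
  using assms unfolding word_value_def numeral_2_eq_2 length_Suc_conv by force

text \<open>The inclusion-exclusion difference, which annihilates every term depending on one field
  alone.\<close>

definition mixed_part :: "(cmat3 \<Rightarrow> cmat3 \<Rightarrow> real) \<Rightarrow> cmat3 \<Rightarrow> cmat3 \<Rightarrow> real" where
  "mixed_part V X Y = V X Y - V X 0 - V 0 Y + V 0 0"

lemma mixed_part_invariant:
  assumes "flavour_invariant V" "unitary G" "unitary Gu" "unitary Gd"
  shows "mixed_part V (G ** X ** hconj Gu) (G ** Y ** hconj Gd) = mixed_part V X Y"
proof -
  have "V (G ** X ** hconj Gu) (G ** Y ** hconj Gd) = V X Y" for X Y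
    using assms by (simp add: flavour_invariant_def)
  from this[of X Y] this[of X 0] this[of 0 Y] this[of 0 0] show ?thesis
    by (simp add: mixed_part_def)
qed

text \<open>The element -1 of the right-handed factor of one sector changes the sign of that field
  only, so the two signs can be flipped independently.\<close>

lemma flavour_invariant_uminus:
  assumes "flavour_invariant V"
  shows "V (- X) Y = V X Y" "V X (- Y) = V X Y"
proof -
  have u: "unitary (- mat 1)"
    by (simp add: unitary_def vec_eq_iff matrix_mult_nth mat_def forall_3 sum_3)
  have m: "A ** hconj (- mat 1) = - A" for A :: cmat3
    by (simp add: vec_eq_iff matrix_mult_nth mat_def forall_3 sum_3)
  have inv: "V (mat 1 ** X ** hconj Gu) (mat 1 ** Y ** hconj Gd) = V X Y"
    if "unitary Gu" "unitary Gd" for Gu Gd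
    using assms that unitary_mat_1 unfolding flavour_invariant_def by blast
  show "V (- X) Y = V X Y"
    using inv[OF u unitary_mat_1] by (simp only: m hconj_mat_1 matrix_mul_lid matrix_mul_rid)
  show "V X (- Y) = V X Y"
    using inv[OF unitary_mat_1 u] by (simp only: m hconj_mat_1 matrix_mul_lid matrix_mul_rid)
qed

text \<open>Averaging over the signs of both arguments leaves only the monomials of bidegree (2,2).\<close>

lemma mixed_part_words:
  assumes "renormalizable V" "flavour_invariant V"
  shows "\<exists>(J :: (field_var \<Rightarrow>\<^sub>0 nat) set) us ds c.
    (\<forall>m\<in>J. length (us m) = 2 \<and> length (ds m) = 2) \<and>
    (\<forall>X Y. complex_of_real (mixed_part V X Y) =
        (\<Sum>m\<in>J. c m * word_value X (us m) * word_value Y (ds m)))"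
proof -
  obtain I :: "(field_var \<Rightarrow>\<^sub>0 nat) set" and us ds c where I: "finite I"
    "\<forall>m\<in>I. length (us m) + length (ds m) \<le> 4"
    "\<forall>X Y. complex_of_real (V X Y) = (\<Sum>m\<in>I. c m * word_value X (us m) * word_value Y (ds m))"
    using renormalizable_words[OF assms(1)] by blast
  define J where "J = {m \<in> I. length (us m) = 2 \<and> length (ds m) = 2}"
  \<comment> \<open>Twice the even part of a word minus twice its constant part: it is zero on the
    empty word and on odd words, and doubles words of length two.\<close>
  define h where "h Z xs = word_value Z xs + word_value (- Z) xs - 2 * word_value 0 xs" for Z xs
  have h_other: "h Z xs = 0" if "xs = [] \<or> odd (length xs)" for Z xs
    using that by (auto simp: h_def word_value_uminus word_value_0) (auto simp: word_value_def)
  have h_2: "h Z xs = 2 * word_value Z xs" if "length xs = 2" for Z xs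
    using that by (auto simp: h_def word_value_uminus word_value_0)
  have summand: "c m * h X (us m) * h Y (ds m) =
      (if m \<in> J then 4 * (c m * word_value X (us m) * word_value Y (ds m)) else 0)" if "m \<in> I" for m X Y
  proof (cases "m \<in> J")
    case True
    then show ?thesis by (simp add: J_def h_2)
  next
    case False
    \<comment> \<open>Two nonempty words of even length have total length at least 4, and the degree
      bound then makes both lengths exactly 2.\<close>
    have "us m = [] \<or> odd (length (us m)) \<or> ds m = [] \<or> odd (length (ds m))"
    proof (rule ccontr)
      assume neg: "\<not> ?thesis"
      have "2 \<le> length xs" if "xs \<noteq> []" "even (length xs)" for xs :: "field_var list"
        using that by (cases xs rule: remdups_adj.cases) auto
      with neg have "length (us m) \<ge> 2" "length (ds m) \<ge> 2"
        by blast+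
      moreover have "length (us m) + length (ds m) \<le> 4"
        using I(2) \<open>m \<in> I\<close> by blast
      ultimately show False
        using False \<open>m \<in> I\<close> by (simp add: J_def)
    qed
    with False show ?thesis by (auto simp: h_other)
  qed
  show ?thesis
  proof (intro exI conjI ballI allI)
    fix X Y
    \<comment> \<open>The right-hand side is what expanding the products of the \<open>h\<close>
      factors gives; by invariance under signs it is four copies of the mixed part.\<close>
    have "4 * complex_of_real (mixed_part V X Y) = complex_of_real (V X Y + V (- X) Y + V X (- Y) + V (- X) (- Y)
        - 2 * (V X 0 + V (- X) 0) - 2 * (V 0 Y + V 0 (- Y)) + 4 * V 0 0)"
      by (simp add: mixed_part_def flavour_invariant_uminus[OF assms(2)])
    also have "\<dots> = (\<Sum>m\<in>I. c m * h X (us m) * h Y (ds m))"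
      by (simp add: I(3) h_def algebra_simps sum.distrib sum_subtractf sum_distrib_left)
    also have "\<dots> = (\<Sum>m\<in>I. if m \<in> J then 4 * (c m * word_value X (us m) * word_value Y (ds m)) else 0)"
      by (rule sum.cong) (simp_all only: summand)
    also have "\<dots> = (\<Sum>m\<in>J. 4 * (c m * word_value X (us m) * word_value Y (ds m)))"
      using I(1) by (simp add: J_def sum.inter_filter)
    finally show "complex_of_real (mixed_part V X Y) = (\<Sum>m\<in>J. c m * word_value X (us m) * word_value Y (ds m))"
      by (simp flip: sum_distrib_left)
  qed (auto simp: J_def)
qed

text \<open>A real quadratic form, encoded by the parallelogram law. Only real scalars are
  extracted, since the entries appear together with their conjugates.\<close>

definition quadratic_map :: "('a::real_vector \<Rightarrow> real) \<Rightarrow> bool" where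
  "quadratic_map f \<longleftrightarrow> (\<forall>x y. f (x + y) + f (x - y) = 2 * f x + 2 * f y) \<and>
     (\<forall>r x. f (r *\<^sub>R x) = r\<^sup>2 * f x)"

lemma quadratic_map_words:
  assumes len: "\<And>m. m \<in> J \<Longrightarrow> length (ws m) = 2"
    and f: "\<And>Z. complex_of_real (f Z) = (\<Sum>m\<in>J. c m * word_value Z (ws m))"
  shows "quadratic_map f"
proof -
  have par: "word_value (X + Y) xs + word_value (X - Y) xs = 2 * word_value X xs + 2 * word_value Y xs"
    if xs: "length xs = 2" for X Y xs
  proof -
    obtain a b where "\<And>Z. word_value Z xs = entry_value Z a * entry_value Z b"
      using word_value_length_2[OF xs] by blast
    then show ?thesis
      by (simp add: entry_value_add entry_value_diff algebra_simps)
  qed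
  have hom: "word_value (r *\<^sub>R X) xs = of_real (r\<^sup>2) * word_value X xs"
    if xs: "length xs = 2" for r X xs
  proof -
    obtain a b where "\<And>Z. word_value Z xs = entry_value Z a * entry_value Z b"
      using word_value_length_2[OF xs] by blast
    then show ?thesis
      by (simp add: entry_value_scaleR power2_eq_square)
  qed
  have "complex_of_real (f (X + Y) + f (X - Y)) = complex_of_real (2 * f X + 2 * f Y)" for X Y
  proof -
    have "complex_of_real (f (X + Y) + f (X - Y)) =
        (\<Sum>m\<in>J. c m * (word_value (X + Y) (ws m) + word_value (X - Y) (ws m)))"
      by (simp add: f distrib_left sum.distrib)
    also have "\<dots> = (\<Sum>m\<in>J. c m * (2 * word_value X (ws m) + 2 * word_value Y (ws m)))"
      by (rule sum.cong) (simp_all add: par len)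
    finally show ?thesis
      by (simp add: f distrib_left sum.distrib sum_distrib_left mult_ac)
  qed
  moreover have "complex_of_real (f (r *\<^sub>R X)) = complex_of_real (r\<^sup>2 * f X)" for r X
  proof -
    have "complex_of_real (f (r *\<^sub>R X)) = (\<Sum>m\<in>J. c m * (of_real (r\<^sup>2) * word_value X (ws m)))"
      unfolding f by (rule sum.cong) (simp_all only: hom len)
    then show ?thesis
      by (simp add: f sum_distrib_left mult_ac)
  qed
  ultimately show ?thesis
    unfolding quadratic_map_def of_real_eq_iff by blast
qed

lemma quadratic_map_mixed_part:
  assumes "renormalizable V" "flavour_invariant V"
  shows "quadratic_map (\<lambda>X. mixed_part V X Y)" "quadratic_map (mixed_part V X)"
proof -
  obtain J :: "(field_var \<Rightarrow>\<^sub>0 nat) set" and us ds c where J: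
    "\<forall>m\<in>J. length (us m) = 2 \<and> length (ds m) = 2"
    "\<forall>X Y. complex_of_real (mixed_part V X Y) =
        (\<Sum>m\<in>J. c m * word_value X (us m) * word_value Y (ds m))"
    using mixed_part_words[OF assms] by blast
  show "quadratic_map (\<lambda>X. mixed_part V X Y)"
    by (rule quadratic_map_words[of J us _ "\<lambda>m. c m * word_value Y (ds m)"]) (simp_all add: J mult_ac)
  show "quadratic_map (mixed_part V X)"
    by (rule quadratic_map_words[of J ds _ "\<lambda>m. c m * word_value X (us m)"]) (simp_all add: J)
qed

lemma quadratic_map_0: "quadratic_map f \<Longrightarrow> f 0 = 0"
  unfolding quadratic_map_def by (metis mult_zero_left power_zero_numeral scaleR_zero_left)

text \<open>If each summand can have its sign flipped on its own by a symmetry of \<open>f\<close>, the summands are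
  orthogonal for the bilinear form of \<open>f\<close>.\<close>

lemma quadratic_map_sum:
  assumes f: "quadratic_map f" and "finite K"
    and T: "\<And>k x. k \<in> K \<Longrightarrow> f (T k x) = f x" "\<And>k x y. k \<in> K \<Longrightarrow> T k (x + y) = T k x + T k y"
      "\<And>k. k \<in> K \<Longrightarrow> T k (z k) = - z k" "\<And>k l. k \<in> K \<Longrightarrow> l \<in> K \<Longrightarrow> l \<noteq> k \<Longrightarrow> T k (z l) = z l"
  shows "f (\<Sum>k\<in>K. z k) = (\<Sum>k\<in>K. f (z k))"
  using \<open>finite K\<close> T
proof (induction K)
  case empty
  then show ?case using quadratic_map_0[OF f] by simp
next
  case (insert k K)
  let ?s = "\<Sum>l\<in>K. z l"
  have "T k 0 = 0"
    using insert.prems(2)[of k 0 0] by simp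
  have Tadd: "T k (x + y) = T k x + T k y" for x y
    using insert.prems(2) by blast
  have Tfix: "T k (z l) = z l" if "l \<in> K" "l \<noteq> k" for l
    using insert.prems(4) that by blast
  have "T k (\<Sum>l\<in>L. z l) = (\<Sum>l\<in>L. z l)" if "finite L" "L \<subseteq> K" for L
    using that
  proof (induction L)
    case (insert l L)
    then have "l \<in> K" "l \<noteq> k"
      using \<open>k \<notin> K\<close> by auto
    with insert show ?case
      using Tadd Tfix by simp
  qed (use \<open>T k 0 = 0\<close> in simp)
  then have "T k ?s = ?s"
    using insert.hyps by blast
  \<comment> \<open>The symmetry \<open>T k\<close> fixes the partial sum and negates the new
    summand, so the two terms of the parallelogram law coincide.\<close>
  then have "f (?s + z k) = f (?s - z k)"
    using insert.prems(1)[of k "?s + z k"] insert.prems(2,3)[of k] by simp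
  moreover have "f (?s + z k) + f (?s - z k) = 2 * f ?s + 2 * f (z k)"
    using f by (simp add: quadratic_map_def)
  moreover have "f ?s = (\<Sum>k\<in>K. f (z k))"
    using insert by simp
  ultimately show ?case
    using insert.hyps by (simp add: add.commute)
qed

subsection \<open>Invariant biquadratic forms\<close>

definition unit_mat :: "3 \<Rightarrow> 3 \<Rightarrow> complex \<Rightarrow> cmat3" where
  "unit_mat m n z = (\<chi> i j. if i = m \<and> j = n then z else 0)"

lemma unit_mat_nth: "unit_mat m n z $ i $ j = (if i = m \<and> j = n then z else 0)"
  by (simp add: unit_mat_def)

abbreviation perm_mat :: "(3 \<Rightarrow> 3) \<Rightarrow> cmat3" where
  "perm_mat \<sigma> \<equiv> (\<chi> i j. if i = \<sigma> j then 1 else 0)"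

lemma unitary_perm_mat:
  assumes "inj \<sigma>"
  shows "unitary (perm_mat \<sigma>)"
proof (rule unitaryI)
  have "(hconj (perm_mat \<sigma>) ** perm_mat \<sigma>) $ i $ j = mat 1 $ i $ j" for i j
    using assms
    by (simp add: matrix_mult_nth mat_def inj_eq if_distrib[where f="\<lambda>x. x * _"]
        if_distrib[where f=cnj] cong: if_cong)
  then show "hconj (perm_mat \<sigma>) ** perm_mat \<sigma> = mat 1"
    by (simp add: vec_eq_iff)
qed

lemma unit_mat_mult_nth: "(unit_mat m n z ** A) $ i $ j = (if i = m then z * A $ n $ j else 0)"
  by (simp add: matrix_mult_nth unit_mat_nth if_distrib[where f="\<lambda>x. x * _"] cong: if_cong)

lemma mult_unit_mat_nth: "(A ** unit_mat m n z) $ i $ j = (if j = n then A $ i $ m * z else 0)"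
  by (simp add: matrix_mult_nth unit_mat_nth if_distrib[where f="\<lambda>x. _ * x"] cong: if_cong)

lemma perm_mat_unit_mat:
  "perm_mat \<sigma> ** unit_mat m n z ** hconj (perm_mat \<tau>) = unit_mat (\<sigma> m) (\<tau> n) z"
proof -
  have 1: "perm_mat \<sigma> ** unit_mat m n z = unit_mat (\<sigma> m) n z"
    by (simp add: vec_eq_iff mult_unit_mat_nth unit_mat_nth)
  have 2: "unit_mat (\<sigma> m) n z ** hconj (perm_mat \<tau>) = unit_mat (\<sigma> m) (\<tau> n) z"
    by (simp add: vec_eq_iff unit_mat_mult_nth unit_mat_nth)
  show ?thesis
    by (simp only: 1 2)
qed

section \<open>Sign flips of single rows and columns\<close>

definition flip_mat :: "3 \<Rightarrow> cmat3" where
  "flip_mat k = diag (\<lambda>i. if i = k then -1 else 1)"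

lemma unitary_diag: "(\<And>i. norm (f i) = 1) \<Longrightarrow> unitary (diag f)"
  using diagonal_unitary_diag diagonal_unitary_def by blast

lemma unitary_flip_mat: "unitary (flip_mat k)"
  unfolding flip_mat_def by (rule unitary_diag) simp

lemma hconj_flip_mat: "hconj (flip_mat k) = flip_mat k"
  by (simp add: vec_eq_iff flip_mat_def diag_nth)

lemma flip_mat_mult_nth: "(flip_mat k ** A) $ i $ j = (if i = k then - A $ i $ j else A $ i $ j)"
  by (simp add: flip_mat_def)

lemma mult_flip_mat_nth: "(A ** flip_mat k) $ i $ j = (if j = k then - A $ i $ j else A $ i $ j)"
  by (simp add: flip_mat_def)

lemma matrix_add_rdistrib: "((A :: cmat3) + B) ** C = A ** C + B ** C"
  by (simp add: vec_eq_iff matrix_mult_nth distrib_right sum.distrib)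

text \<open>Isolates what the classification takes from the mixed part of a quartic; from here on
  polynomials no longer appear.\<close>

locale invariant_biquadratic =
  fixes N :: "cmat3 \<Rightarrow> cmat3 \<Rightarrow> real"
  assumes quad1: "quadratic_map (\<lambda>X. N X Y)" and quad2: "quadratic_map (N X)"
    and inv: "unitary G \<Longrightarrow> unitary Gu \<Longrightarrow> unitary Gd \<Longrightarrow>
      N (G ** X ** hconj Gu) (G ** Y ** hconj Gd) = N X Y"
begin

text \<open>The phase of \<open>z\<close> is absorbed by a scalar unitary of the down sector, which
  does not touch \<open>X\<close>; homogeneity then extracts the modulus.\<close>

lemma unit_mat_scale: "N X (unit_mat m n z) = (norm z)\<^sup>2 * N X (unit_mat m n 1)"
proof (cases "z = 0")
  case True
  then have "unit_mat m n z = 0"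
    by (simp add: vec_eq_iff unit_mat_nth)
  with True show ?thesis
    using quadratic_map_0[OF quad2] by simp
next
  case False
  define w where "w = z / norm z"
  have w: "norm w = 1"
    using False by (simp add: w_def norm_divide)
  have "unit_mat m n z = norm z *\<^sub>R (mat 1 ** unit_mat m n 1 ** hconj (diag (\<lambda>_. cnj w)))"
    using False by (simp add: vec_eq_iff unit_mat_nth w_def scaleR_conv_of_real[of _ "_ :: complex"])
  then have "N X (unit_mat m n z) = (norm z)\<^sup>2 * N (mat 1 ** X ** hconj (mat 1)) (mat 1 ** unit_mat m n 1 ** hconj (diag (\<lambda>_. cnj w)))"
    using quad2[of X] by (simp add: quadratic_map_def)
  also have "\<dots> = (norm z)\<^sup>2 * N X (unit_mat m n 1)"
    by (subst inv) (use w in \<open>auto intro: unitary_diag\<close>)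
  finally show ?thesis .
qed

text \<open>Flipping column \<open>k\<close> of the up field negates the \<open>k\<close>-th
  diagonal unit, fixes the others and leaves \<open>Y\<close> alone, so the diagonal units are
  orthogonal for the form.\<close>

lemma diag_expand:
  "N (diag (\<lambda>i. complex_of_real (s i))) Y = (\<Sum>i\<in>UNIV. (s i)\<^sup>2 * N (unit_mat i i 1) Y)"
proof -
  have "diag (\<lambda>i. complex_of_real (s i)) = (\<Sum>i\<in>UNIV. s i *\<^sub>R unit_mat i i 1)"
    by (simp add: vec_eq_iff diag_nth unit_mat_nth forall_3 sum_3 scaleR_conv_of_real[of _ "_ :: complex"])
  also have "N \<dots> Y = (\<Sum>i\<in>UNIV. N (s i *\<^sub>R unit_mat i i 1) Y)"
  proof (rule quadratic_map_sum[OF quad1, where T="\<lambda>k X. X ** flip_mat k"])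
    show "N (X ** flip_mat k) Y = N X Y" for k X
      using inv[of "mat 1" "flip_mat k" "mat 1" X Y] by (simp add: hconj_flip_mat unitary_flip_mat)
  qed (auto simp: vec_eq_iff mult_flip_mat_nth unit_mat_nth matrix_add_rdistrib)
  also have "\<dots> = (\<Sum>i\<in>UNIV. (s i)\<^sup>2 * N (unit_mat i i 1) Y)"
    using quad1[of Y] by (simp add: quadratic_map_def)
  finally show ?thesis .
qed

text \<open>First the rows of \<open>Y\<close> are separated by flips in the shared left-handed
  factor, then the entries within a row by flips in the right-handed down factor.\<close>

lemma unit_mat_expand:
  "N (unit_mat i i 1) Y = (\<Sum>m\<in>UNIV. \<Sum>n\<in>UNIV. (norm (Y $ m $ n))\<^sup>2 * N (unit_mat i i 1) (unit_mat m n 1))"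
proof -
  have "Y = (\<Sum>m\<in>UNIV. \<Sum>n\<in>UNIV. unit_mat m n (Y $ m $ n))"
    by (simp add: vec_eq_iff unit_mat_nth forall_3 sum_3)
  then have "N (unit_mat i i 1) Y = N (unit_mat i i 1) (\<Sum>m\<in>UNIV. \<Sum>n\<in>UNIV. unit_mat m n (Y $ m $ n))"
    by simp
  also have "\<dots> = (\<Sum>m\<in>UNIV. N (unit_mat i i 1) (\<Sum>n\<in>UNIV. unit_mat m n (Y $ m $ n)))"
  proof (rule quadratic_map_sum[OF quad2, where T="\<lambda>k X. flip_mat k ** X"])
    \<comment> \<open>A left flip also acts on the up field; a right-handed up flip with the same
      index compensates for it.\<close>
    have *: "flip_mat k ** unit_mat i i 1 ** flip_mat k = unit_mat i i 1" for k
      by (simp add: vec_eq_iff mult_flip_mat_nth flip_mat_mult_nth unit_mat_nth)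
    show "N (unit_mat i i 1) (flip_mat k ** X) = N (unit_mat i i 1) X" for k X
      using inv[of "flip_mat k" "flip_mat k" "mat 1" "unit_mat i i 1" X]
      by (simp add: hconj_flip_mat unitary_flip_mat *)
  qed (auto simp: vec_eq_iff flip_mat_mult_nth unit_mat_nth matrix_add_ldistrib sum_3)
  also have "\<dots> = (\<Sum>m\<in>UNIV. \<Sum>n\<in>UNIV. N (unit_mat i i 1) (unit_mat m n (Y $ m $ n)))"
  proof (rule sum.cong[OF refl], rule quadratic_map_sum[OF quad2, where T="\<lambda>k X. X ** flip_mat k"])
    show "N (unit_mat i i 1) (X ** flip_mat k) = N (unit_mat i i 1) X" for k X
      using inv[of "mat 1" "mat 1" "flip_mat k" "unit_mat i i 1" X]
      by (simp add: hconj_flip_mat unitary_flip_mat)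
  qed (auto simp: vec_eq_iff mult_flip_mat_nth unit_mat_nth matrix_add_rdistrib)
  finally show ?thesis
    by (subst (asm) unit_mat_scale)
qed

text \<open>The column indices can be permuted separately in each sector, whereas the row indices
  are permuted together. The only invariant of the pair is whether the two rows agree.\<close>

lemma unit_mat_values:
  "N (unit_mat i i 1) (unit_mat m n 1) =
    (if m = i then N (unit_mat 1 1 1) (unit_mat 1 1 1) else N (unit_mat 1 1 1) (unit_mat 2 1 1))"
proof -
  have perm: "N (unit_mat i i 1) (unit_mat m n 1) = N (unit_mat (\<sigma> i) 1 1) (unit_mat (\<sigma> m) 1 1)"
    if "inj \<sigma>" for \<sigma>
    using inv[of "perm_mat \<sigma>" "perm_mat (Transposition.transpose i 1)" "perm_mat (Transposition.transpose n 1)"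
        "unit_mat i i 1" "unit_mat m n 1"] that
    by (simp add: perm_mat_unit_mat unitary_perm_mat)
  show ?thesis
  proof (cases "m = i")
    case True
    then show ?thesis
      using perm[of "Transposition.transpose i 1"] by simp
  next
    case False
    \<comment> \<open>The inner transposition sends \<open>i\<close> to 1; the outer one sends the
      image of \<open>m\<close> to 2 and fixes 1, because that image differs from 1.\<close>
    let ?\<sigma> = "Transposition.transpose (Transposition.transpose i 1 m) 2 \<circ> Transposition.transpose i 1"
    have "inj ?\<sigma>"
      by (intro inj_compose) simp_all
    moreover have "?\<sigma> i = 1" "?\<sigma> m = 2"
      using False by (auto simp: Transposition.transpose_def)
    ultimately show ?thesis
      using perm[of ?\<sigma>] False by simp
  qed
qed

lemma biquadratic_formula:
  assumes "unitary U" "unitary W" "X = U ** diag (\<lambda>i. complex_of_real (s i)) ** hconj W"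
  shows "complex_of_real (N X Y) =
    complex_of_real (N (unit_mat 1 1 1) (unit_mat 2 1 1)) * trace (gram X) * trace (gram Y) +
    complex_of_real (N (unit_mat 1 1 1) (unit_mat 1 1 1) - N (unit_mat 1 1 1) (unit_mat 2 1 1)) *
      trace (gram X ** gram Y)"
proof -
  let ?a = "N (unit_mat 1 1 1) (unit_mat 1 1 1)" and ?b = "N (unit_mat 1 1 1) (unit_mat 2 1 1)"
  let ?D = "diag (\<lambda>i. complex_of_real (s i))"
  \<comment> \<open>The left rotation that diagonalises \<open>X\<close> is applied to
    \<open>Y\<close> as well; \<open>Z\<close> therefore carries the relative orientation.\<close>
  define Z where "Z = hconj U ** Y"
  have "N X Y = N (U ** ?D ** hconj W) (U ** Z ** hconj (mat 1))"
    using assms by (simp add: Z_def unitary_cancel)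
  also have "\<dots> = N ?D Z"
    using assms by (intro inv) simp_all
  also have "\<dots> = (\<Sum>i\<in>UNIV. (s i)\<^sup>2 * (\<Sum>m\<in>UNIV. \<Sum>n\<in>UNIV. (norm (Z $ m $ n))\<^sup>2 * (if m = i then ?a else ?b)))"
    unfolding diag_expand by (subst unit_mat_expand, subst unit_mat_values) rule
  \<comment> \<open>The weight is \<open>?b\<close> everywhere plus \<open>?a - ?b\<close> where the
    rows agree. The uniform part becomes the product of the traces, the excess becomes the trace of
    the product.\<close>
  also have "\<dots> = ?b * (\<Sum>i\<in>UNIV. (s i)\<^sup>2) * (\<Sum>m\<in>UNIV. \<Sum>n\<in>UNIV. (norm (Z $ m $ n))\<^sup>2) +
      (?a - ?b) * (\<Sum>i\<in>UNIV. (s i)\<^sup>2 * (\<Sum>n\<in>UNIV. (norm (Z $ i $ n))\<^sup>2))"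
    by (simp add: sum_3 algebra_simps)
  finally have NXY: "N X Y = \<dots>" .
  have DD: "gram X = U ** diag (\<lambda>i. complex_of_real ((s i)\<^sup>2)) ** hconj U"
    by (rule gram_svd[OF assms(2,3)])
  have GZ: "gram Z = hconj U ** gram Y ** U"
    by (simp add: gram_def Z_def hconj_mult matrix_mul_assoc)
  have tX: "trace (gram X) = complex_of_real (\<Sum>i\<in>UNIV. (s i)\<^sup>2)"
    by (rule trace_gram_svd[OF assms])
  have tY: "trace (gram Y) = complex_of_real (\<Sum>m\<in>UNIV. \<Sum>n\<in>UNIV. (norm (Z $ m $ n))\<^sup>2)"
  proof -
    have "trace (gram Z) = trace (gram Y)"
      unfolding GZ by (subst trace_cyclic) (simp add: unitary_cancel[OF assms(1)])
    then show ?thesis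
      by (simp add: trace_gram)
  qed
  have "trace (gram X ** gram Y) = trace (diag (\<lambda>i. complex_of_real ((s i)\<^sup>2)) ** gram Z)"
    unfolding DD GZ by (metis matrix_mul_assoc trace_mul_sym)
  also have "\<dots> = complex_of_real (\<Sum>i\<in>UNIV. (s i)\<^sup>2 * (\<Sum>n\<in>UNIV. (norm (Z $ i $ n))\<^sup>2))"
    by (simp add: trace_def gram_def[of Z] matrix_mult_nth[of Z] complex_norm_square del: of_real_power)
  finally show ?thesis
    unfolding NXY tX tY by simp
qed

end

subsection \<open>The general renormalizable invariant\<close>

lemma invariant_biquadratic_mixed_part:
  assumes "renormalizable V" "flavour_invariant V"
  shows "invariant_biquadratic (mixed_part V)"
  by unfold_locales
    (simp_all add: quadratic_map_mixed_part[OF assms] mixed_part_invariant[OF assms(2)])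

lemma flavour_invariant_svd:
  assumes "flavour_invariant V" "unitary U" "unitary W"
  shows "V (U ** D ** hconj W) 0 = V D 0" "V 0 (U ** D ** hconj W) = V 0 D"
proof -
  have "V (U ** X ** hconj W) (U ** Y ** hconj W) = V X Y" for X Y
    using assms unfolding flavour_invariant_def by blast
  from this[of D 0] this[of 0 D] show "V (U ** D ** hconj W) 0 = V D 0" "V 0 (U ** D ** hconj W) = V 0 D"
    by simp_all
qed

text \<open>Invariance lets the pure parts be evaluated at a diagonal representative that is
  determined by the set of singular values. The product of the two traces depends on these sets too,
  so only the trace of the product sees the orientation.\<close>

theorem renormalizable_form:
  assumes "renormalizable V" "flavour_invariant V"
  obtains F :: "real set \<Rightarrow> real set \<Rightarrow> real" and \<kappa> :: real where
    "\<And>X Y. three_distinct_nonzero_sv X \<Longrightarrow> three_distinct_nonzero_sv Y \<Longrightarrow>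
      complex_of_real (V X Y) = complex_of_real (F (singular_values X) (singular_values Y)) +
        complex_of_real \<kappa> * trace (gram X ** gram Y)"
proof -
  interpret invariant_biquadratic "mixed_part V"
    by (rule invariant_biquadratic_mixed_part[OF assms])
  let ?a = "mixed_part V (unit_mat 1 1 1) (unit_mat 1 1 1)"
  let ?b = "mixed_part V (unit_mat 1 1 1) (unit_mat 2 1 1)"
  \<comment> \<open>A fixed choice of ordering for each set makes the diagonal representative a
    function of the set.\<close>
  define s :: "real set \<Rightarrow> 3 \<Rightarrow> real" where "s S = (SOME s. bij_betw s UNIV S)" for S
  define D where "D S = diag (\<lambda>i. complex_of_real (s S i))" for S
  define F where "F S T = V (D S) 0 + V 0 (D T) - V 0 0 + ?b * (\<Sum>x\<in>S. x\<^sup>2) * (\<Sum>x\<in>T. x\<^sup>2)" for S T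
  have svd: "\<exists>U W. unitary U \<and> unitary W \<and> X = U ** D (singular_values X) ** hconj W"
    and tr: "trace (gram X) = complex_of_real (\<Sum>x\<in>singular_values X. x\<^sup>2)"
    if X: "three_distinct_nonzero_sv X" for X
  proof -
    have "card (singular_values X) = CARD(3)"
      using X by (simp add: three_distinct_nonzero_sv_def)
    moreover from this have "finite (singular_values X)"
      by (intro card_ge_0_finite) simp
    ultimately have "\<exists>s :: 3 \<Rightarrow> real. bij_betw s UNIV (singular_values X)"
      by (intro finite_same_card_bij) simp_all
    then have bij: "bij_betw (s (singular_values X)) UNIV (singular_values X)"
      unfolding s_def by (rule someI_ex)
    from exists_svd[OF X bij]
    show ex: "\<exists>U W. unitary U \<and> unitary W \<and> X = U ** D (singular_values X) ** hconj W"
      by (simp add: D_def)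
    then obtain U W where uU: "unitary U" and uW: "unitary W"
      and XU: "X = U ** D (singular_values X) ** hconj W"
      by blast
    have "trace (gram X) = complex_of_real (\<Sum>i\<in>UNIV. (s (singular_values X) i)\<^sup>2)"
      by (rule trace_gram_svd[OF uU uW XU[unfolded D_def]])
    also have "(\<Sum>i\<in>UNIV. (s (singular_values X) i)\<^sup>2) = (\<Sum>x\<in>singular_values X. x\<^sup>2)"
      by (rule sum.reindex_bij_betw[OF bij])
    finally show "trace (gram X) = complex_of_real (\<Sum>x\<in>singular_values X. x\<^sup>2)" .
  qed
  have "complex_of_real (V X Y) = complex_of_real (F (singular_values X) (singular_values Y)) +
      complex_of_real (?a - ?b) * trace (gram X ** gram Y)"
    if X: "three_distinct_nonzero_sv X" and Y: "three_distinct_nonzero_sv Y" for X Y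
  proof -
    obtain U W where U: "unitary U" "unitary W" "X = U ** D (singular_values X) ** hconj W"
      using svd[OF X] by blast
    obtain U' W' where U': "unitary U'" "unitary W'" "Y = U' ** D (singular_values Y) ** hconj W'"
      using svd[OF Y] by blast
    have VX: "V X 0 = V (D (singular_values X)) 0"
      by (subst U(3)) (rule flavour_invariant_svd[OF assms(2) U(1,2)])
    have VY: "V 0 Y = V 0 (D (singular_values Y))"
      by (subst U'(3)) (rule flavour_invariant_svd[OF assms(2) U'(1,2)])
    have "complex_of_real (mixed_part V X Y) = complex_of_real ?b * trace (gram X) * trace (gram Y) +
        complex_of_real (?a - ?b) * trace (gram X ** gram Y)"
      by (rule biquadratic_formula[OF U(1,2) U(3)[unfolded D_def]])
    moreover have "complex_of_real (V X Y) = complex_of_real (mixed_part V X Y) +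
        complex_of_real (V X 0 + V 0 Y - V 0 0)"
      by (simp add: mixed_part_def)
    ultimately show ?thesis
      by (simp add: F_def tr[OF X] tr[OF Y] VX VY)
  qed
  then show ?thesis
    by (rule that)
qed

subsection \<open>One-parameter families of unitary matrices\<close>

definition smult_mat :: "complex \<Rightarrow> cmat3 \<Rightarrow> cmat3" where
  "smult_mat z A = (\<chi> i j. z * A $ i $ j)"

lemma smult_mat_nth [simp]: "smult_mat z A $ i $ j = z * A $ i $ j"
  by (simp add: smult_mat_def)

lemma smult_mat_mult [simp]:
  "smult_mat z A ** B = smult_mat z (A ** B)" "A ** smult_mat z B = smult_mat z (A ** B)"
  by (simp_all add: vec_eq_iff matrix_mult_nth sum_distrib_left mult_ac)

lemma hconj_smult_mat [simp]: "hconj (smult_mat z A) = smult_mat (cnj z) (hconj A)"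
  by (simp add: vec_eq_iff)

lemma smult_smult_mat [simp]: "smult_mat z (smult_mat w A) = smult_mat (z * w) A"
  by (simp add: vec_eq_iff)

lemma smult_mat_add: "smult_mat z (A + B) = smult_mat z A + smult_mat z B"
  by (simp add: vec_eq_iff distrib_left)

lemma trace_smult_mat [simp]: "trace (smult_mat z A) = z * trace A"
  by (simp add: trace_def sum_distrib_left)

lemma hconj_add: "hconj (A + B) = hconj A + hconj B"
  by (simp add: vec_eq_iff)

definition projector :: "cmat3 \<Rightarrow> bool" where
  "projector P \<longleftrightarrow> hconj P = P \<and> P ** P = P"

text \<open>This is \<open>exp (\<i> t P)\<close> for a projector \<open>P\<close>; written with real scalars, it is visibly
  differentiable in \<open>t\<close>.\<close>

definition phase_rotation :: "cmat3 \<Rightarrow> real \<Rightarrow> cmat3" where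
  "phase_rotation P t = mat 1 + (cos t - 1) *\<^sub>R P + sin t *\<^sub>R smult_mat \<i> P"

lemma phase_rotation_eq: "phase_rotation P t = mat 1 + smult_mat (cis t - 1) P"
  by (simp add: vec_eq_iff phase_rotation_def scaleR_conv_of_real[of _ "_ :: complex"] complex_eq_iff
      algebra_simps)

lemma phase_rotation_0 [simp]: "phase_rotation P 0 = mat 1"
  by (simp add: phase_rotation_def)

lemma unitary_phase_rotation:
  assumes "projector P"
  shows "unitary (phase_rotation P t)"
proof (rule unitaryI)
  define z where "z = cis t - 1"
  \<comment> \<open>This is the identity \<bar>1 + z\<bar>^2 = 1, written out for
    \<open>1 + z = cis t\<close>.\<close>
  have z: "z + (cnj z + cnj z * z) = 0"
    by (simp add: z_def complex_eq_iff algebra_simps)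
  have "hconj (phase_rotation P t) ** phase_rotation P t =
      mat 1 + smult_mat z P + smult_mat (cnj z) P + smult_mat (cnj z * z) P"
    using assms by (simp add: phase_rotation_eq projector_def hconj_add matrix_add_ldistrib
        matrix_add_rdistrib smult_mat_add z_def[symmetric] add_ac mult.commute)
  also have "\<dots> = mat 1 + smult_mat (z + (cnj z + cnj z * z)) P"
    by (simp add: vec_eq_iff algebra_simps)
  finally show "hconj (phase_rotation P t) ** phase_rotation P t = mat 1"
    by (simp add: z vec_eq_iff)
qed

lemma differentiable_phase_rotation: "phase_rotation P differentiable at t"
proof -
  have "((\<lambda>t. mat 1 + (cos t - 1) *\<^sub>R P + sin t *\<^sub>R smult_mat \<i> P) has_vector_derivative
      (- sin t) *\<^sub>R P + cos t *\<^sub>R smult_mat \<i> P) (at t)"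
    by (auto intro!: derivative_eq_intros simp: has_real_derivative_iff_has_vector_derivative[symmetric])
  then show ?thesis
    unfolding phase_rotation_def[abs_def] by (rule differentiableI_vector)
qed

lemma continuous_on_phase_rotation: "continuous_on S (phase_rotation P)"
  unfolding phase_rotation_def[abs_def] by (intro continuous_intros)

lemma projector_conj:
  assumes "projector P" "unitary U"
  shows "projector (U ** P ** hconj U)"
proof -
  have "U ** P ** hconj U ** (U ** P ** hconj U) = U ** (P ** (hconj U ** (U ** P))) ** hconj U"
    by (simp add: matrix_mul_assoc)
  also have "\<dots> = U ** P ** hconj U"
    using assms(1) by (simp only: unitary_cancel[OF assms(2)] projector_def)
  finally show ?thesis
    using assms(1) by (simp add: projector_def hconj_mult matrix_mul_assoc)
qed

text \<open>The projector onto the line spanned by \<open>e\<^sub>i + c e\<^sub>j\<close>, for \<open>i \<noteq> j\<close> and \<open>\<bar>c\<bar> = 1\<close>.\<close>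

definition pair_projector :: "3 \<Rightarrow> 3 \<Rightarrow> complex \<Rightarrow> cmat3" where
  "pair_projector i j c = (let u = (\<lambda>k. if k = i then 1 else if k = j then c else 0) in
     (\<chi> k l. u k * cnj (u l) / 2))"

lemma sum_two_points:
  fixes x y :: "'a::finite \<Rightarrow> 'b::comm_monoid_add"
  assumes "i \<noteq> j"
  shows "(\<Sum>k\<in>UNIV. if k = i then x k else if k = j then y k else 0) = x i + y j"
proof -
  have "(\<Sum>k\<in>UNIV. if k = i then x k else if k = j then y k else 0) =
      (\<Sum>k\<in>UNIV. (if k = i then x k else 0) + (if k = j then y k else 0))"
    using assms by (intro sum.cong) auto
  then show ?thesis
    by (simp add: sum.distrib)
qed

lemma pair_projector_mult_nth:
  assumes "i \<noteq> j"
  shows "(pair_projector i j c ** A) $ k $ n =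
    (if k = i then 1 else if k = j then c else 0) * (A $ i $ n + cnj c * A $ j $ n) / 2"
proof -
  let ?u = "\<lambda>k. if k = i then 1 else if k = j then c else 0"
  have "(pair_projector i j c ** A) $ k $ n =
      ?u k * (\<Sum>l\<in>UNIV. cnj (?u l) * A $ l $ n) / 2"
    by (simp add: pair_projector_def Let_def matrix_mult_nth sum_distrib_left sum_divide_distrib mult_ac)
  also have "(\<Sum>l\<in>UNIV. cnj (?u l) * A $ l $ n) =
      (\<Sum>l\<in>UNIV. if l = i then A $ l $ n else if l = j then cnj c * A $ l $ n else 0)"
    by (rule sum.cong) auto
  also have "\<dots> = A $ i $ n + cnj c * A $ j $ n"
    using assms by (rule sum_two_points)
  finally show ?thesis .
qed

lemma projector_pair_projector:
  assumes "i \<noteq> j" "norm c = 1"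
  shows "projector (pair_projector i j c)"
proof -
  have c: "cnj c * c = 1"
    using complex_norm_square[of c] assms(2) by (simp add: mult.commute)
  have "(pair_projector i j c ** pair_projector i j c) $ k $ l = pair_projector i j c $ k $ l" for k l
    unfolding pair_projector_mult_nth[OF assms(1)]
    using assms(1) c by (auto simp: pair_projector_def Let_def mult.assoc[symmetric])
  then show ?thesis
    by (simp add: projector_def vec_eq_iff) (simp add: pair_projector_def Let_def)
qed

lemma trace_pair_projector:
  assumes "i \<noteq> j" "norm c = 1"
  shows "2 * trace (pair_projector i j c ** A) = A $ i $ i + A $ j $ j + cnj c * A $ j $ i + c * A $ i $ j"
proof -
  have c: "c * cnj c = 1"
    using complex_norm_square[of c] assms(2) by simp
  have "2 * trace (pair_projector i j c ** A) =
      (\<Sum>k\<in>UNIV. if k = i then A $ i $ k + cnj c * A $ j $ k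
        else if k = j then c * (A $ i $ k + cnj c * A $ j $ k) else 0)"
    unfolding trace_def pair_projector_mult_nth[OF assms(1)] sum_distrib_left
    by (rule sum.cong) auto
  also have "\<dots> = A $ i $ i + cnj c * A $ j $ i + c * (A $ i $ j + cnj c * A $ j $ j)"
    using assms(1) by (rule sum_two_points)
  finally show ?thesis
    using c by (simp add: distrib_left mult.assoc[symmetric])
qed

text \<open>The pair projectors already suffice. For a fixed pair of indices, the phases 1, -1 and
  \<open>\<i>\<close> separate the two off-diagonal entries from the sum of the diagonal ones; the
  three pairwise diagonal sums then determine the diagonal.\<close>

lemma matrix_0_if_projector_traces_0:
  assumes "\<And>P. projector P \<Longrightarrow> trace (P ** A) = 0"
  shows "A = 0"
proof -
  have q: "A $ i $ i + A $ j $ j + cnj c * A $ j $ i + c * A $ i $ j = 0"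
    if "i \<noteq> j" "norm c = 1" for i j c
    using trace_pair_projector[OF that, of A] assms[OF projector_pair_projector[OF that]] by simp
  have off: "A $ i $ j = 0" "A $ i $ i + A $ j $ j = 0" if "i \<noteq> j" for i j
  proof -
    define S where "S = A $ i $ i + A $ j $ j"
    have 1: "S + A $ j $ i + A $ i $ j = 0" and 2: "S - A $ j $ i - A $ i $ j = 0"
      and 3: "S - \<i> * A $ j $ i + \<i> * A $ i $ j = 0"
      using q[OF that, of 1] q[OF that, of "-1"] q[OF that, of \<i>] by (simp_all add: S_def)
    have S: "S = 0"
      using 1 2 by algebra
    then have "\<i> * (A $ i $ j - A $ j $ i) = 0"
      using 3 by (simp add: algebra_simps)
    then have "A $ i $ j = A $ j $ i"
      by simp
    with 1 S show "A $ i $ j = 0" "A $ i $ i + A $ j $ j = 0"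
      by (simp_all add: S_def)
  qed
  have "A $ 1 $ 1 + A $ 2 $ 2 = 0" "A $ 1 $ 1 + A $ 3 $ 3 = 0" "A $ 2 $ 2 + A $ 3 $ 3 = 0"
    by (rule off(2); simp)+
  then have "A $ 1 $ 1 = 0" "A $ 2 $ 2 = 0" "A $ 3 $ 3 = 0"
    by algebra+
  then have "A $ i $ i = 0" for i
    using exhaust_3[of i] by auto
  with off(1) show ?thesis
    by (auto simp: vec_eq_iff) metis
qed

section \<open>Variation of the orientation term along a phase rotation\<close>

lemma gram_mult: "gram (g ** A) = g ** gram A ** hconj g"
  by (simp add: gram_def hconj_mult matrix_mul_assoc)

lemma trace_gram_phase_rotation:
  assumes "projector P"
  shows "trace (X ** gram (phase_rotation P t ** A)) = trace (X ** gram A)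
    + (cis t - 1) * trace (X ** P ** gram A) + (cis (- t) - 1) * trace (X ** gram A ** P)
    + (cis t - 1) * (cis (- t) - 1) * trace (X ** P ** gram A ** P)"
proof -
  define z where "z = cis t - 1"
  have "gram (phase_rotation P t ** A) = (mat 1 + smult_mat z P) ** gram A ** (mat 1 + smult_mat (cnj z) P)"
    using assms unfolding gram_mult phase_rotation_eq z_def by (simp add: projector_def hconj_add)
  also have "\<dots> = gram A + smult_mat z (P ** gram A) + smult_mat (cnj z) (gram A ** P)
      + smult_mat (z * cnj z) (P ** gram A ** P)"
    by (simp add: matrix_add_ldistrib matrix_add_rdistrib smult_mat_add mult.commute)
  finally show ?thesis
    by (simp add: matrix_add_ldistrib trace_add matrix_mul_assoc z_def cis_cnj)
qed

lemma trace_gram_phase_rotation_derivative: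
  assumes "projector P"
  shows "((\<lambda>t. trace (X ** gram (phase_rotation P t ** A))) has_vector_derivative
    \<i> * trace (P ** (gram A ** X - X ** gram A))) (at 0)"
proof -
  \<comment> \<open>An extension to complex arguments, so that complex differentiation applies
    before restricting to the real line. The last summand vanishes to second order at 0 and
    contributes nothing to the derivative.\<close>
  define H where "H w = trace (X ** gram A) + (exp (\<i> * w) - 1) * trace (X ** P ** gram A)
      + (exp (- \<i> * w) - 1) * trace (X ** gram A ** P)
      + (exp (\<i> * w) - 1) * (exp (- \<i> * w) - 1) * trace (X ** P ** gram A ** P)" for w
  have "(H has_field_derivative \<i> * trace (X ** P ** gram A) - \<i> * trace (X ** gram A ** P)) (at (of_real 0))"
    unfolding H_def[abs_def] by (auto intro!: derivative_eq_intros)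
  then have "((\<lambda>t. H (of_real t)) has_vector_derivative
      \<i> * trace (X ** P ** gram A) - \<i> * trace (X ** gram A ** P)) (at 0)"
    by (rule has_vector_derivative_real_field)
  moreover have "H (of_real t) = trace (X ** gram (phase_rotation P t ** A))" for t
    by (simp add: H_def trace_gram_phase_rotation[OF assms] cis_conv_exp)
  moreover have "\<i> * trace (X ** P ** gram A) - \<i> * trace (X ** gram A ** P) =
      \<i> * trace (P ** (gram A ** X - X ** gram A))"
  proof -
    have "trace (X ** P ** gram A) = trace (P ** (gram A ** X))"
      by (metis matrix_mul_assoc trace_mul_sym)
    moreover have "trace (X ** gram A ** P) = trace (P ** (X ** gram A))"
      by (metis matrix_mul_assoc trace_mul_sym)
    moreover have "P ** (gram A ** X - X ** gram A) = P ** (gram A ** X) - P ** (X ** gram A)"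
      by (simp add: vec_eq_iff matrix_mult_nth right_diff_distrib sum_subtractf)
    ultimately show ?thesis
      by (simp add: trace_sub right_diff_distrib)
  qed
  ultimately show ?thesis
    by simp
qed

subsection \<open>Stationary orientations\<close>

text \<open>Left rotations keep the singular values, so along each phase rotation only the trace
  term varies. Its derivative pairs an arbitrary projector with the commutator, which must therefore
  vanish.\<close>

lemma stationary_imp_commute:
  assumes V: "\<And>A. three_distinct_nonzero_sv A \<Longrightarrow>
      complex_of_real (V X A) = complex_of_real (F (singular_values A)) + complex_of_real \<kappa> * trace (gram X ** gram A)"
    and "\<kappa> \<noteq> 0" and Y: "three_distinct_nonzero_sv Y" and stat: "stationary_orientation V X Y"
  shows "gram X ** gram Y = gram Y ** gram X"
proof -
  have "trace (P ** (gram Y ** gram X - gram X ** gram Y)) = 0" if P: "projector P" for P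
  proof -
    let ?d = "\<i> * trace (P ** (gram Y ** gram X - gram X ** gram Y))"
    have "((\<lambda>t. V X (phase_rotation P t ** Y)) has_real_derivative 0) (at 0)"
      using stat unitary_phase_rotation[OF P] differentiable_phase_rotation[of P 0]
      unfolding stationary_orientation_def by simp
    then have "((\<lambda>t. complex_of_real (V X (phase_rotation P t ** Y))) has_vector_derivative of_real 0) (at 0)"
      by (intro has_vector_derivative_of_real)
        (simp add: has_real_derivative_iff_has_vector_derivative)
    moreover have "complex_of_real (V X (phase_rotation P t ** Y)) =
        complex_of_real (F (singular_values Y)) + complex_of_real \<kappa> * trace (gram X ** gram (phase_rotation P t ** Y))" for t
      using V[of "phase_rotation P t ** Y"] Y
      by (simp add: three_distinct_unitary singular_values_unitary unitary_phase_rotation[OF P])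
    ultimately have D0: "((\<lambda>t. complex_of_real (F (singular_values Y)) + complex_of_real \<kappa> *
        trace (gram X ** gram (phase_rotation P t ** Y))) has_vector_derivative 0) (at 0)"
      by simp
    have "((\<lambda>t. complex_of_real (F (singular_values Y)) + complex_of_real \<kappa> *
        trace (gram X ** gram (phase_rotation P t ** Y))) has_vector_derivative 0 + complex_of_real \<kappa> * ?d) (at 0)"
      by (intro has_vector_derivative_add has_vector_derivative_const has_vector_derivative_mult_right
          trace_gram_phase_rotation_derivative[OF P])
    from vector_derivative_unique_at[OF D0 this] have "complex_of_real \<kappa> * ?d = 0"
      by simp
    with \<open>\<kappa> \<noteq> 0\<close> show ?thesis
      by simp
  qed
  then have "gram Y ** gram X - gram X ** gram Y = 0"
    by (rule matrix_0_if_projector_traces_0)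
  then show ?thesis
    by simp
qed

text \<open>Rows of a unitary matrix are nonzero, so each has exactly one nonzero entry, in column
  \<open>\<sigma> i\<close>. Orthogonality of the rows makes \<open>\<sigma>\<close> injective, and
  their normalisation makes these entries phases.\<close>

lemma monomial_unitary_is_permutation:
  assumes V: "unitary V" and mono: "\<And>i j k. V $ i $ j \<noteq> 0 \<Longrightarrow> V $ i $ k \<noteq> 0 \<Longrightarrow> j = k"
  shows "permutation_up_to_phases V"
proof -
  have "\<exists>j. V $ i $ j \<noteq> 0" for i
  proof (rule ccontr)
    assume "\<nexists>j. V $ i $ j \<noteq> 0"
    then show False
      using unitary_row[OF V, of i i] by simp
  qed
  then obtain \<sigma> where \<sigma>: "\<And>i. V $ i $ \<sigma> i \<noteq> 0"
    by metis
  have zero: "V $ i $ j = 0" if "j \<noteq> \<sigma> i" for i j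
    using mono \<sigma> that by metis
  have row: "(if \<sigma> i = \<sigma> k then V $ i $ \<sigma> i * cnj (V $ k $ \<sigma> k) else 0) = (if i = k then 1 else 0)" for i k
  proof -
    have "(\<Sum>j\<in>UNIV. V $ i $ j * cnj (V $ k $ j)) =
        (\<Sum>j\<in>UNIV. if j = \<sigma> i then (if \<sigma> i = \<sigma> k then V $ i $ \<sigma> i * cnj (V $ k $ \<sigma> k) else 0) else 0)"
      by (rule sum.cong) (auto simp: zero)
    then show ?thesis
      using unitary_row[OF V, of i k] by simp
  qed
  have "inj \<sigma>"
  proof (rule injI, rule ccontr)
    fix i k assume "\<sigma> i = \<sigma> k" "i \<noteq> k"
    then show False
      using row[of i k] \<sigma>[of i] \<sigma>[of k] by simp
  qed
  then have bij: "bij \<sigma>"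
    by (simp add: bij_def finite_UNIV_inj_surj)
  have phase: "norm (V $ i $ \<sigma> i) = 1" for i
  proof -
    have "complex_of_real ((norm (V $ i $ \<sigma> i))\<^sup>2) = 1"
      unfolding complex_norm_square using row[of i i] by simp
    then show ?thesis
      by (metis norm_ge_zero of_real_eq_1_iff power2_eq_iff_nonneg one_power2 zero_le_one)
  qed
  \<comment> \<open>The inverse appears because \<open>\<sigma>\<close> maps rows to columns, while
    a permutation matrix is described by a map from columns to rows.\<close>
  define P :: cmat3 where "P = (\<chi> i j. if i = inv \<sigma> j then 1 else 0)"
  have "permutation_matrix P"
    unfolding permutation_matrix_def P_def using bij bij_imp_bij_inv by blast
  moreover have "V = diag (\<lambda>i. V $ i $ \<sigma> i) ** P ** diag (\<lambda>i. 1)"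
  proof -
    have "i = inv \<sigma> j \<longleftrightarrow> j = \<sigma> i" for i j
      using bij by (metis bij_inv_eq_iff)
    then show ?thesis
      by (auto simp: vec_eq_iff P_def zero)
  qed
  moreover have "diagonal_unitary (diag (\<lambda>i. V $ i $ \<sigma> i))" "diagonal_unitary (diag (\<lambda>i. 1))"
    using phase by (auto intro: diagonal_unitary_diag)
  ultimately show ?thesis
    unfolding permutation_up_to_phases_def rephasing_equiv_def by blast
qed

text \<open>In an eigenbasis of \<open>gram X\<close>, whose spectrum is simple, the commuting
  \<open>gram Y\<close> is diagonal. The columns of the CKM matrix are eigenvectors of this diagonal
  matrix with distinct eigenvalues, so no row can meet two of them.\<close>

lemma commute_imp_permutation:
  assumes "three_distinct_nonzero_sv X" "three_distinct_nonzero_sv Y"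
    and svd: "is_svd X Uu Du Wu" "is_svd Y Ud Dd Wd"
    and comm: "gram X ** gram Y = gram Y ** gram X"
  shows "permutation_up_to_phases (ckm Uu Ud)"
proof -
  obtain a where a: "Du = diag (\<lambda>i. complex_of_real (a i))" "inj a" "\<And>i. a i > 0"
    using svd_diag_inj[OF assms(1) svd(1)] by metis
  obtain b where b: "Dd = diag (\<lambda>i. complex_of_real (b i))" "inj b" "\<And>i. b i > 0"
    using svd_diag_inj[OF assms(2) svd(2)] by metis
  have un: "unitary Uu" "unitary Wu" "unitary Ud" "unitary Wd"
    using svd by (simp_all add: is_svd_def)
  let ?A = "diag (\<lambda>i. complex_of_real ((a i)\<^sup>2))" and ?B = "diag (\<lambda>i. complex_of_real ((b i)\<^sup>2))"
  have gX: "gram X = Uu ** ?A ** hconj Uu"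
    by (rule gram_svd[OF un(2)]) (use svd(1) in \<open>simp add: is_svd_def a(1)\<close>)
  have gY: "gram Y = Ud ** ?B ** hconj Ud"
    by (rule gram_svd[OF un(4)]) (use svd(2) in \<open>simp add: is_svd_def b(1)\<close>)
  define V where "V = ckm Uu Ud"
  have V: "unitary V"
    unfolding V_def ckm_def using un by (simp add: unitary_mult)
  \<comment> \<open>\<open>gram Y\<close> expressed in the eigenbasis \<open>Uu\<close> of
    \<open>gram X\<close>.\<close>
  define K where "K = V ** ?B ** hconj V"
  have K: "K = hconj Uu ** gram Y ** Uu"
    by (simp add: K_def V_def ckm_def gY hconj_mult matrix_mul_assoc)
  have "?A ** K = hconj Uu ** (gram X ** gram Y) ** Uu"
    by (simp add: K gX matrix_mul_assoc unitary_cancel[OF un(1)])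
  also have "\<dots> = K ** ?A"
    unfolding comm by (simp add: K gX matrix_mul_assoc unitary_cancel[OF un(1)])
  finally have "(?A ** K) $ i $ j = (K ** ?A) $ i $ j" for i j
    by simp
  then have K0: "K $ i $ j = 0" if "i \<noteq> j" for i j
  proof -
    have "complex_of_real ((a i)\<^sup>2) * K $ i $ j = complex_of_real ((a j)\<^sup>2) * K $ i $ j"
      using \<open>\<And>i j. (?A ** K) $ i $ j = (K ** ?A) $ i $ j\<close>[of i j] by (simp add: mult.commute)
    moreover have "(a i)\<^sup>2 \<noteq> (a j)\<^sup>2"
      using a(3)[of i] a(3)[of j] injD[OF a(2)] that by (metis power2_eq_imp_eq less_imp_le)
    ultimately show ?thesis
      by (metis mult_cancel_right of_real_eq_iff)
  qed
  have KV: "K ** V = V ** ?B"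
    by (simp add: K_def unitary_cancel[OF V])
  have ev: "K $ i $ i * V $ i $ j = V $ i $ j * complex_of_real ((b j)\<^sup>2)" for i j
  proof -
    have "(K ** V) $ i $ j = (\<Sum>k\<in>UNIV. if k = i then K $ i $ i * V $ i $ j else 0)"
      unfolding matrix_mult_nth by (rule sum.cong) (auto simp: K0)
    then show ?thesis
      by (auto simp: KV)
  qed
  have "permutation_up_to_phases V"
  proof (rule monomial_unitary_is_permutation[OF V])
    fix i j k
    assume "V $ i $ j \<noteq> 0" "V $ i $ k \<noteq> 0"
    then have "K $ i $ i = complex_of_real ((b j)\<^sup>2)" "K $ i $ i = complex_of_real ((b k)\<^sup>2)"
      using ev[of i j] ev[of i k] by (simp_all add: mult.commute)
    then have "(b j)\<^sup>2 = (b k)\<^sup>2"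
      by (metis of_real_eq_iff)
    then show "j = k"
      using b(3)[of j] b(3)[of k] injD[OF b(2)] by (metis power2_eq_imp_eq less_imp_le)
  qed
  then show ?thesis
    by (simp add: V_def)
qed

subsection \<open>Flat directions\<close>

lemma rephasing_equiv_norm:
  assumes "rephasing_equiv V V'"
  shows "norm (V' $ i $ j) = norm (V $ i $ j)"
proof -
  obtain P Q where "diagonal_unitary P" "diagonal_unitary Q" and V': "V' = P ** V ** Q"
    using assms by (auto simp: rephasing_equiv_def)
  then obtain f g where "P = diag f" "\<And>i. norm (f i) = 1" "Q = diag g" "\<And>i. norm (g i) = 1"
    using diagonal_unitaryE by metis
  then show ?thesis
    by (simp add: V' norm_mult)
qed

text \<open>The squared modulus is \<open>1 - (C * (1 - r\<^sup>2) / 2 + r * S)\<close>, where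
  \<open>C = 1 - cos t\<close> and \<open>S = sin t\<close> are positive. The second term of the
  bracket gives strictness for r > 0, the first one for r = 0.\<close>

lemma phase_rotation_shrinks:
  fixes r t :: real
  assumes "0 \<le> r" "r \<le> 1" "0 < t" "t \<le> 1"
  shows "norm (1 + (cis t - 1) * (1 + \<i> * complex_of_real r) / 2) < 1"
proof -
  define C S where "C = 1 - cos t" and "S = sin t"
  have CS: "C\<^sup>2 + S\<^sup>2 = 2 * C"
    using sin_cos_squared_add[of t] by (simp add: C_def S_def power2_eq_square algebra_simps)
  have "S > 0"
    unfolding S_def using assms pi_gt3 by (intro sin_gt_zero) auto
  have "C > 0"
    unfolding C_def using cos_monotone_0_pi[of 0 t] assms pi_gt3 by simp
  let ?z = "1 + (cis t - 1) * (1 + \<i> * complex_of_real r) / 2"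
  have "Re ?z = 1 - (C + r * S) / 2" "Im ?z = (S - r * C) / 2"
    by (simp_all add: C_def S_def field_simps)
  then have "(norm ?z)\<^sup>2 = (1 - (C + r * S) / 2)\<^sup>2 + ((S - r * C) / 2)\<^sup>2"
    by (simp only: cmod_power2)
  also have "\<dots> = 1 - C - r * S + (1 + r\<^sup>2) * (C\<^sup>2 + S\<^sup>2) / 4"
    by (simp add: power2_eq_square field_simps)
  also have "\<dots> = 1 - (C * (1 - r\<^sup>2) / 2 + r * S)"
    by (simp add: CS field_simps)
  also have "\<dots> < 1"
  proof -
    have "r\<^sup>2 \<le> 1"
      using assms by (simp add: power_le_one)
    show ?thesis
    proof (cases "r = 0")
      case True
      then show ?thesis using \<open>C > 0\<close> by simp
    next
      case False
      then have "r * S > 0" "C * (1 - r\<^sup>2) \<ge> 0"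
        using assms(1) \<open>S > 0\<close> \<open>C > 0\<close> \<open>r\<^sup>2 \<le> 1\<close> by simp_all
      then show ?thesis by simp
    qed
  qed
  finally show ?thesis
    by (simp add: power2_less_1_iff)
qed

text \<open>The largest entry of the first column is mixed with another entry of that column, at a
  phase that makes its modulus drop at once and stay below its initial value for all times up to
  1.\<close>

lemma exists_moving_rotation:
  assumes V: "unitary V"
  shows "\<exists>P. projector P \<and> (\<forall>t\<in>{0<..1}. \<not> rephasing_equiv V (phase_rotation P t ** V))"
proof -
  define w where "w k = V $ k $ 1" for k
  \<comment> \<open>Maximality gives both \<open>w i \<noteq> 0\<close> and a ratio \<open>r\<close>
    of at most 1.\<close>
  obtain i where i: "\<And>k. norm (w k) \<le> norm (w i)"
  proof -
    have "finite (range (\<lambda>k. norm (w k)))" by simp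
    then have "Max (range (\<lambda>k. norm (w k))) \<in> range (\<lambda>k. norm (w k))"
      by (rule Max_in) simp
    then obtain i where "norm (w i) = Max (range (\<lambda>k. norm (w k)))"
      by (metis imageE)
    then show ?thesis
      using that[of i] by simp
  qed
  have wi: "w i \<noteq> 0"
  proof
    assume "w i = 0"
    then have "w k = 0" for k
      using i[of k] by simp
    then show False
      using unitary_row[of "hconj V" 1 1] V by (simp add: w_def)
  qed
  obtain j where "i \<noteq> j"
    by (metis one_neq_zero zero_neq_numeral numeral_eq_one_iff exhaust_3 num.distinct(1))
  define r where "r = norm (w j) / norm (w i)"
  have r: "0 \<le> r" "r \<le> 1"
    using i[of j] wi by (simp_all add: r_def)
  \<comment> \<open>With this phase the rotation multiplies the entry \<open>w i\<close> by the factor of the previous lemma.\<close>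
  obtain c where c: "norm c = 1" "cnj c * w j = \<i> * complex_of_real r * w i"
  proof (cases "w j = 0")
    case True
    then show ?thesis
      using that[of 1] by (simp add: r_def)
  next
    case False
    then show ?thesis
      using that[of "cnj (\<i> * complex_of_real r * w i / w j)"] wi
      by (simp add: norm_mult norm_divide r_def)
  qed
  let ?P = "pair_projector i j c"
  have "\<not> rephasing_equiv V (phase_rotation ?P t ** V)" if t: "t \<in> {0<..1}" for t
  proof
    assume "rephasing_equiv V (phase_rotation ?P t ** V)"
    then have "norm ((phase_rotation ?P t ** V) $ i $ 1) = norm (w i)"
      unfolding w_def by (rule rephasing_equiv_norm)
    moreover have "(phase_rotation ?P t ** V) $ i $ 1 = w i + (cis t - 1) * (w i + cnj c * w j) / 2"
      using \<open>i \<noteq> j\<close>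
      by (simp add: phase_rotation_eq matrix_add_rdistrib pair_projector_mult_nth w_def)
    moreover have "\<dots> = w i * (1 + (cis t - 1) * (1 + \<i> * complex_of_real r) / 2)"
      unfolding c(2) by (simp add: field_simps)
    ultimately have "norm (w i) * norm (1 + (cis t - 1) * (1 + \<i> * complex_of_real r) / 2) = norm (w i)"
      by (simp only: norm_mult)
    then show False
      using phase_rotation_shrinks[OF r, of t] t wi by simp
  qed
  then show ?thesis
    using projector_pair_projector[OF \<open>i \<noteq> j\<close> c(1)] by blast
qed

text \<open>Translates between frames: rotating \<open>Ud\<close> with the conjugated projector
  rotates the CKM matrix with \<open>P\<close> itself.\<close>

lemma phase_rotation_conj:
  fixes A :: cmat3
  assumes "unitary U"
  shows "hconj U ** (phase_rotation (U ** P ** hconj U) t ** A) = phase_rotation P t ** (hconj U ** A)"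
proof -
  have "hconj U ** (U ** P ** hconj U ** A) = hconj U ** (U ** (P ** (hconj U ** A)))"
    by (simp add: matrix_mul_assoc)
  then show ?thesis
    by (simp add: phase_rotation_eq matrix_add_rdistrib matrix_add_ldistrib unitary_cancel[OF assms])
qed

lemma continuous_flat_direction_if_invariant:
  assumes const: "\<And>g. unitary g \<Longrightarrow> V X (g ** Y) = V X Y" and un: "unitary Uu" "unitary Ud"
  shows "continuous_flat_direction V X Y Uu Ud"
proof -
  have "unitary (ckm Uu Ud)"
    using un by (simp add: ckm_def unitary_mult)
  then obtain P where P: "projector P"
    "\<And>t. t \<in> {0<..1} \<Longrightarrow> \<not> rephasing_equiv (ckm Uu Ud) (phase_rotation P t ** ckm Uu Ud)"
    using exists_moving_rotation by blast
  let ?\<gamma> = "phase_rotation (Uu ** P ** hconj Uu)"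
  have "unitary (?\<gamma> t)" for t
    using P(1) un(1) by (intro unitary_phase_rotation projector_conj)
  moreover have "ckm Uu (?\<gamma> t ** Ud) = phase_rotation P t ** ckm Uu Ud" for t
    by (simp add: ckm_def phase_rotation_conj[OF un(1)])
  ultimately show ?thesis
    unfolding continuous_flat_direction_def
    by (intro exI[of _ ?\<gamma>])
      (simp add: path_def pathstart_def continuous_on_phase_rotation const P(2))
qed

text \<open>When the potential is constant, every rotated orientation is stationary. Points of the
  flat path near its start are then arbitrarily close stationary orientations in other rephasing
  classes.\<close>

lemma not_isolated_if_flat:
  assumes const: "\<And>g. unitary g \<Longrightarrow> V X (g ** Y) = V X Y"
    and flat: "continuous_flat_direction V X Y Uu Ud"
  shows "\<not> isolated_stationary_orientation V X Y Uu Ud"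
proof
  assume "isolated_stationary_orientation V X Y Uu Ud"
  then obtain \<epsilon> where "\<epsilon> > 0" and iso: "\<And>g. unitary g \<Longrightarrow> stationary_orientation V X (g ** Y) \<Longrightarrow>
      dist (ckm Uu (g ** Ud)) (ckm Uu Ud) < \<epsilon> \<Longrightarrow> rephasing_equiv (ckm Uu Ud) (ckm Uu (g ** Ud))"
    unfolding isolated_stationary_orientation_def by blast
  obtain \<gamma> where \<gamma>: "path \<gamma>" "pathstart \<gamma> = mat 1" "\<And>t. t \<in> {0..1} \<Longrightarrow> unitary (\<gamma> t)"
    "\<And>t. t \<in> {0<..1} \<Longrightarrow> \<not> rephasing_equiv (ckm Uu Ud) (ckm Uu (\<gamma> t ** Ud))"
    using flat unfolding continuous_flat_direction_def by blast
  have stat: "stationary_orientation V X (g ** Y)" if "unitary g" for g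
    unfolding stationary_orientation_def
    using const that by (simp add: matrix_mul_assoc unitary_mult)
  have "continuous_on {0..1} \<gamma>"
    using \<gamma>(1) by (simp add: path_def)
  then have "continuous_on {0..1} (\<lambda>t. ckm Uu (\<gamma> t ** Ud))"
    unfolding ckm_def matrix_matrix_mult_def by (intro continuous_intros)
  moreover have "ckm Uu (\<gamma> 0 ** Ud) = ckm Uu Ud"
    using \<gamma>(2) by (simp add: pathstart_def)
  ultimately obtain \<delta> where \<delta>: "\<delta> > 0"
    "\<And>t. t \<in> {0..1} \<Longrightarrow> dist t 0 < \<delta> \<Longrightarrow> dist (ckm Uu (\<gamma> t ** Ud)) (ckm Uu Ud) < \<epsilon>"
    using \<open>\<epsilon> > 0\<close> unfolding continuous_on_iff by (metis atLeastAtMost_iff order_refl zero_le_one)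
  \<comment> \<open>A positive time inside both the path's domain and the continuity radius.\<close>
  define t where "t = min 1 (\<delta> / 2)"
  have t: "t \<in> {0<..1}" "t \<in> {0..1}" "dist t 0 < \<delta>"
    using \<delta>(1) by (auto simp: t_def)
  show False
    using iso[OF \<gamma>(3)[OF t(2)] stat[OF \<gamma>(3)[OF t(2)]] \<delta>(2)[OF t(2,3)]] \<gamma>(4)[OF t(1)] by blast
qed

section \<open>Form of the potential, rigidity, flatness and absence of isolated orientations
  combined\<close>

theorem theorem1:
  fixes V :: "cmat3 \<Rightarrow> cmat3 \<Rightarrow> real"
  assumes "renormalizable V" and "flavour_invariant V"
  shows "(\<exists>(F :: real set \<Rightarrow> real set \<Rightarrow> real) (\<kappa> :: real).
      (\<forall>\<Omega>u \<Omega>d. three_distinct_nonzero_sv \<Omega>u \<and> three_distinct_nonzero_sv \<Omega>d \<longrightarrow>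
         complex_of_real (V \<Omega>u \<Omega>d) =
           complex_of_real (F (singular_values \<Omega>u) (singular_values \<Omega>d)) +
           complex_of_real \<kappa> * trace (gram \<Omega>u ** gram \<Omega>d)) \<and>
      (\<kappa> \<noteq> 0 \<longrightarrow>
         (\<forall>\<Omega>u \<Omega>d. three_distinct_nonzero_sv \<Omega>u \<and> three_distinct_nonzero_sv \<Omega>d \<and>
            stationary_orientation V \<Omega>u \<Omega>d \<longrightarrow>
            gram \<Omega>u ** gram \<Omega>d = gram \<Omega>d ** gram \<Omega>u \<and>
            (\<forall>Uu Du Wu Ud Dd Wd. is_svd \<Omega>u Uu Du Wu \<and> is_svd \<Omega>d Ud Dd Wd \<longrightarrow>
               permutation_up_to_phases (ckm Uu Ud)))) \<and>
      (\<kappa> = 0 \<longrightarrow>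
         (\<forall>\<Omega>u \<Omega>d. three_distinct_nonzero_sv \<Omega>u \<and> three_distinct_nonzero_sv \<Omega>d \<longrightarrow>
            (\<forall>g. unitary g \<longrightarrow> V \<Omega>u (g ** \<Omega>d) = V \<Omega>u \<Omega>d) \<and>
            (\<forall>Uu Du Wu Ud Dd Wd. is_svd \<Omega>u Uu Du Wu \<and> is_svd \<Omega>d Ud Dd Wd \<longrightarrow>
               continuous_flat_direction V \<Omega>u \<Omega>d Uu Ud)))) \<and>
    \<not> (\<exists>\<Omega>u \<Omega>d Uu Du Wu Ud Dd Wd.
      three_distinct_nonzero_sv \<Omega>u \<and> three_distinct_nonzero_sv \<Omega>d \<and>
      is_svd \<Omega>u Uu Du Wu \<and> is_svd \<Omega>d Ud Dd Wd \<and>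
      isolated_stationary_orientation V \<Omega>u \<Omega>d Uu Ud \<and>
      \<not> permutation_up_to_phases (ckm Uu Ud))"
proof -
  obtain F \<kappa> where form: "\<And>X Y. three_distinct_nonzero_sv X \<Longrightarrow> three_distinct_nonzero_sv Y \<Longrightarrow>
      complex_of_real (V X Y) = complex_of_real (F (singular_values X) (singular_values Y)) +
        complex_of_real \<kappa> * trace (gram X ** gram Y)"
    using renormalizable_form[OF assms] by metis
  have commute: "gram X ** gram Y = gram Y ** gram X"
    if "\<kappa> \<noteq> 0" "three_distinct_nonzero_sv X" "three_distinct_nonzero_sv Y" "stationary_orientation V X Y"
    for X Y
    by (rule stationary_imp_commute[where F="F (singular_values X)"]) (use form that in auto)
  have perm: "permutation_up_to_phases (ckm Uu Ud)"
    if "\<kappa> \<noteq> 0" "three_distinct_nonzero_sv X" "three_distinct_nonzero_sv Y" "stationary_orientation V X Y"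
      "is_svd X Uu Du Wu" "is_svd Y Ud Dd Wd" for X Y Uu Du Wu Ud Dd Wd
    using commute_imp_permutation[OF that(2,3,5,6) commute[OF that(1-4)]] .
  have const: "V X (g ** Y) = V X Y"
    if "\<kappa> = 0" "three_distinct_nonzero_sv X" "three_distinct_nonzero_sv Y" "unitary g" for X Y g
  proof -
    have "complex_of_real (V X (g ** Y)) = complex_of_real (V X Y)"
      using that by (simp add: form three_distinct_unitary singular_values_unitary)
    then show ?thesis
      by simp
  qed
  have flat: "continuous_flat_direction V X Y Uu Ud"
    if "\<kappa> = 0" "three_distinct_nonzero_sv X" "three_distinct_nonzero_sv Y"
      "is_svd X Uu Du Wu" "is_svd Y Ud Dd Wd" for X Y Uu Du Wu Ud Dd Wd
    using const[OF that(1-3)] that(4,5)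
    by (intro continuous_flat_direction_if_invariant) (simp_all add: is_svd_def)
  \<comment> \<open>For \<open>\<kappa> = 0\<close> the flat direction contradicts isolation;
    otherwise stationarity alone forces a permutation.\<close>
  have isolated: "permutation_up_to_phases (ckm Uu Ud)"
    if "three_distinct_nonzero_sv X" "three_distinct_nonzero_sv Y"
      "is_svd X Uu Du Wu" "is_svd Y Ud Dd Wd" "isolated_stationary_orientation V X Y Uu Ud"
    for X Y Uu Du Wu Ud Dd Wd
  proof (cases "\<kappa> = 0")
    case True
    then show ?thesis
      using not_isolated_if_flat[OF const[OF True that(1,2)] flat[OF True that(1-4)]] that(5) by blast
  next
    case False
    then show ?thesis
      using perm[OF False that(1,2) _ that(3,4)] that(5)
      by (simp add: isolated_stationary_orientation_def)
  qed
  show ?thesis (is "?form \<and> ?rigid")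
  proof
    show ?form
      apply (intro exI[of _ F] exI[of _ \<kappa>] conjI impI allI; (elim conjE)?)
      subgoal by (rule form)
      subgoal by (rule commute)
      subgoal by (rule perm)
      subgoal by (rule const)
      subgoal by (rule flat)
      done
    show ?rigid
      by (intro notI, elim exE conjE, erule notE) (rule isolated)
  qed
qed

end
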